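(* Let $(\Omega,\mathcal{A},\mu)$ be a nonatomic semifinite measure space. Then $\mathcal{S}_m\setminus\mathcal{S}_p$ is spaceable in $L_0^{\mathbb{N}}$. In particular, the sets $\mathcal{S}_m\setminus\mathcal{S}_c$, $\mathcal{S}_m\setminus\mathcal{S}_{au}$ and $\mathcal{S}_m\setminus\mathcal{S}_u$ are spaceable in $L_0^{\mathbb{N}}$.
   Context: $(\Omega,\mathcal{A},\mu)$ is a positive measure space with $\mu(\Omega)>0$. It is semifinite if $\mu(A)=\sup\{\mu(B):B\in\mathcal{A},\,B\subset A,\,\mu(B)<\infty\}$ for each $A\in\mathcal{A}$. An atom is a set $A\in\mathcal{A}$ with $\mu(A)>0$ for which there do not exist $B,C\in\mathcal{A}$ with $B\cap C=\varnothing$, $B\cup C=A$, $\mu(B)>0$ and $\mu(C)>0$; the measure space is nonatomic if it has no atoms. $L_0$ is the real vector space of ($\mu$-a.e. equality classes of) measurable functions $f:\Omega\to\mathbb{R}$, with the topology of local convergence in measure, i.e. the vector topology with a base of $0$-neighborhoods given by the sets $\{f\in L_0:\int_K\min\{1,|f|\}\,d\mu<\varepsilon\}$, $\varepsilon>0$, $K\in\mathcal{A}$, $\mu(K)<\infty$. $L_0^{\mathbb{N}}$ is the vector space of all sequences $(f_n)_{n\in\mathbb{N}}$ in $L_0$, with the product topology. Subsets of $L_0^{\mathbb{N}}$: $\mathcal{S}_p$: sequences with $f_n\to0$ pointwise almost everywhere. $\mathcal{S}_u$: $f_n\to0$ uniformly almost everywhere (there is $Z\in\mathcal{A}$ with $\mu(Z)=0$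 and $f_n\to0$ uniformly on $\Omega\setminus Z$). $\mathcal{S}_{au}$: $f_n\to0$ almost uniformly (for every $\varepsilon>0$ there is $Z_\varepsilon\in\mathcal{A}$ with $\mu(Z_\varepsilon)<\varepsilon$ and $f_n\to0$ uniformly on $\Omega\setminus Z_\varepsilon$). $\mathcal{S}_m$: $f_n\to0$ in measure ($\lim_n\mu(\{|f_n|>\varepsilon\})=0$ for every $\varepsilon>0$). $\mathcal{S}_c$: $f_n\to0$ completely ($\sum_{n=1}^\infty\mu(\{|f_n|>\varepsilon\})<\infty$ for every $\varepsilon>0$). A subset $A$ of a topological vector space $X$ is spaceable in $X$ if there is a closed infinite dimensional vector subspace $V\subset X$ with $V\setminus\{0\}\subset A$. *)

theory Defs
  imports "HOL-Analysis.Analysis"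
begin

section \<open>Measure spaces\<close>

text \<open>The library locale \<open>semifinite_measure\<close> does not ask the subset of finite measure
  to have positive measure, and so is satisfied by every measure.\<close>

definition semifinite :: "'a measure \<Rightarrow> bool" where
  "semifinite M \<longleftrightarrow>
     (\<forall>A\<in>sets M. emeasure M A = (SUP B\<in>{B \<in> sets M. B \<subseteq> A \<and> emeasure M B < \<infinity>}. emeasure M B))"

definition measure_atom :: "'a measure \<Rightarrow> 'a set \<Rightarrow> bool" where
  "measure_atom M A \<longleftrightarrow> A \<in> sets M \<and> emeasure M A > 0 \<and>
     \<not> (\<exists>B\<in>sets M. \<exists>C\<in>sets M.
          B \<inter> C = {} \<and> B \<union> C = A \<and> emeasure M B > 0 \<and> emeasure M C > 0)"

definition nonatomic :: "'a measure \<Rightarrow> bool" where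
  "nonatomic M \<longleftrightarrow> (\<nexists>A. measure_atom M A)"

section \<open>Spaceability\<close>

text \<open>Since \<open>L\<^sub>0\<close> depends on the measure, it cannot be made into a type; a
  topological vector space is given by explicit operations on the carrier \<open>topspace (vtop X)\<close>.\<close>

record 'v top_vec =
  vtop :: "'v topology"
  vzero :: 'v
  vadd :: "'v \<Rightarrow> 'v \<Rightarrow> 'v"
  vscale :: "real \<Rightarrow> 'v \<Rightarrow> 'v"

definition vec_subspace :: "'v top_vec \<Rightarrow> 'v set \<Rightarrow> bool" where
  "vec_subspace X V \<longleftrightarrow> V \<subseteq> topspace (vtop X) \<and> vzero X \<in> V \<and>
     (\<forall>u\<in>V. \<forall>v\<in>V. vadd X u v \<in> V) \<and> (\<forall>c. \<forall>v\<in>V. vscale X c v \<in> V)"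

text \<open>The span of \<open>B\<close> is the least subspace containing \<open>B\<close>.\<close>

definition infinite_dimensional :: "'v top_vec \<Rightarrow> 'v set \<Rightarrow> bool" where
  "infinite_dimensional X V \<longleftrightarrow> \<not> (\<exists>B. finite B \<and> B \<subseteq> V \<and> vec_subspace X hull B = V)"

definition spaceable :: "'v top_vec \<Rightarrow> 'v set \<Rightarrow> bool" where
  "spaceable X A \<longleftrightarrow>
     (\<exists>V. closedin (vtop X) V \<and> vec_subspace X V \<and> infinite_dimensional X V \<and> V - {vzero X} \<subseteq> A)"

section \<open>The space \<open>L\<^sub>0\<close>\<close>

definition ae_rel :: "'a measure \<Rightarrow> (('a \<Rightarrow> real) \<times> ('a \<Rightarrow> real)) set" where
  "ae_rel M = {(f, g). f \<in> borel_measurable M \<and> g \<in> borel_measurable M \<and> (AE x in M. f x = g x)}"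

definition ae_class :: "'a measure \<Rightarrow> ('a \<Rightarrow> real) \<Rightarrow> ('a \<Rightarrow> real) set" where
  "ae_class M f = ae_rel M `` {f}"

definition L0 :: "'a measure \<Rightarrow> ('a \<Rightarrow> real) set set" where
  "L0 M = borel_measurable M // ae_rel M"

text \<open>The operations are those on representatives; all members of the unions coincide,
  see \<open>L0_add_class\<close> and \<open>L0_scale_class\<close> below.\<close>

definition L0_add :: "'a measure \<Rightarrow> ('a \<Rightarrow> real) set \<Rightarrow> ('a \<Rightarrow> real) set \<Rightarrow> ('a \<Rightarrow> real) set" where
  "L0_add M F G = (\<Union>f\<in>F. \<Union>g\<in>G. ae_class M (\<lambda>x. f x + g x))"

definition L0_scale :: "'a measure \<Rightarrow> real \<Rightarrow> ('a \<Rightarrow> real) set \<Rightarrow> ('a \<Rightarrow> real) set" where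
  "L0_scale M c F = (\<Union>f\<in>F. ae_class M (\<lambda>x. c * f x))"

definition L0_nhd :: "'a measure \<Rightarrow> 'a set \<Rightarrow> real \<Rightarrow> ('a \<Rightarrow> real) set set" where
  "L0_nhd M K \<epsilon> =
     {ae_class M f |f. f \<in> borel_measurable M \<and> (LINT x:K|M. min 1 \<bar>f x\<bar>) < \<epsilon>}"

text \<open>Local convergence in measure: a set is open iff with each of its points \<open>F\<close> it contains
  a translate of a basic neighbourhood of zero by \<open>F\<close>.  That this is a topology, for which the
  sets \<open>L0_nhd M K \<epsilon>\<close> are a base of neighbourhoods of zero, is shown below.\<close>

definition L0_open :: "'a measure \<Rightarrow> ('a \<Rightarrow> real) set set \<Rightarrow> bool" where
  "L0_open M U \<longleftrightarrow> U \<subseteq> L0 M \<and>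
     (\<forall>F\<in>U. \<exists>K\<in>sets M. \<exists>\<epsilon>>0. emeasure M K < \<infinity> \<and> L0_add M F ` L0_nhd M K \<epsilon> \<subseteq> U)"

definition L0_topology :: "'a measure \<Rightarrow> ('a \<Rightarrow> real) set topology" where
  "L0_topology M = topology (L0_open M)"

definition L0_seqs :: "'a measure \<Rightarrow> (nat \<Rightarrow> ('a \<Rightarrow> real) set) top_vec" where
  "L0_seqs M =
     \<lparr>vtop = product_topology (\<lambda>n. L0_topology M) UNIV,
      vzero = (\<lambda>n. ae_class M (\<lambda>x. 0)),
      vadd = (\<lambda>F G n. L0_add M (F n) (G n)),
      vscale = (\<lambda>c F n. L0_scale M c (F n))\<rparr>"

subsection \<open>Well-definedness\<close>

lemma equiv_ae_rel: "equiv (borel_measurable M) (ae_rel M)"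
proof (rule equivI)
  show "ae_rel M \<subseteq> borel_measurable M \<times> borel_measurable M"
    by (auto simp: ae_rel_def)
  show "refl_on (borel_measurable M) (ae_rel M)"
    by (auto simp: refl_on_def ae_rel_def)
  show "sym (ae_rel M)"
    by (auto simp: sym_def ae_rel_def elim: AE_mp)
  show "trans (ae_rel M)"
  proof (rule transI)
    fix f g h assume *: "(f, g) \<in> ae_rel M" "(g, h) \<in> ae_rel M"
    then have "AE x in M. f x = g x" "AE x in M. g x = h x" by (auto simp: ae_rel_def)
    then have "AE x in M. f x = h x" by eventually_elim simp
    with * show "(f, h) \<in> ae_rel M" by (auto simp: ae_rel_def)
  qed
qed

lemma mem_ae_class:
  "g \<in> ae_class M f \<longleftrightarrow>
     f \<in> borel_measurable M \<and> g \<in> borel_measurable M \<and> (AE x in M. f x = g x)"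
  by (simp add: ae_class_def ae_rel_def)

lemma ae_class_eq_iff:
  assumes "f \<in> borel_measurable M" "g \<in> borel_measurable M"
  shows "ae_class M f = ae_class M g \<longleftrightarrow> (AE x in M. f x = g x)"
  unfolding ae_class_def
  using eq_equiv_class_iff[OF equiv_ae_rel assms] assms by (simp add: ae_rel_def)

lemma L0_eq: "L0 M = ae_class M ` borel_measurable M"
  by (auto simp: L0_def quotient_def ae_class_def)

lemma L0_add_class:
  assumes [measurable]: "f \<in> borel_measurable M" "g \<in> borel_measurable M"
  shows "L0_add M (ae_class M f) (ae_class M g) = ae_class M (\<lambda>x. f x + g x)"
proof -
  have "ae_class M (\<lambda>x. f' x + g' x) = ae_class M (\<lambda>x. f x + g x)"
    if "f' \<in> ae_class M f" "g' \<in> ae_class M g" for f' g'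
  proof -
    from that have [measurable]: "f' \<in> borel_measurable M" "g' \<in> borel_measurable M"
      and ae: "AE x in M. f x = f' x" "AE x in M. g x = g' x"
      by (auto simp: mem_ae_class)
    from ae have "AE x in M. f' x + g' x = f x + g x" by eventually_elim simp
    then show ?thesis by (subst ae_class_eq_iff) auto
  qed
  moreover have "f \<in> ae_class M f" "g \<in> ae_class M g"
    by (auto simp: mem_ae_class)
  ultimately show ?thesis unfolding L0_add_def by blast
qed

lemma L0_scale_class:
  assumes [measurable]: "f \<in> borel_measurable M"
  shows "L0_scale M c (ae_class M f) = ae_class M (\<lambda>x. c * f x)"
proof -
  have "ae_class M (\<lambda>x. c * f' x) = ae_class M (\<lambda>x. c * f x)"
    if "f' \<in> ae_class M f" for f'
  proof -
    from that have [measurable]: "f' \<in> borel_measurable M"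
      and ae: "AE x in M. f x = f' x"
      by (auto simp: mem_ae_class)
    from ae have "AE x in M. c * f' x = c * f x" by eventually_elim simp
    then show ?thesis by (subst ae_class_eq_iff) auto
  qed
  moreover have "f \<in> ae_class M f"
    by (auto simp: mem_ae_class)
  ultimately show ?thesis unfolding L0_scale_def by blast
qed

lemma set_integrable_trunc:
  assumes [measurable]: "K \<in> sets M" "f \<in> borel_measurable M" and "emeasure M K < \<infinity>"
  shows "set_integrable M K (\<lambda>x. min 1 \<bar>f x :: real\<bar>)"
proof -
  have "set_integrable M K (\<lambda>x. 1 :: real)"
    using assms by (simp add: set_integrable_def)
  then show ?thesis
    by (rule set_integrable_bound) (auto simp: set_borel_measurable_def)
qed

lemma set_integral_trunc_mono:
  assumes [measurable]: "K \<in> sets M" "L \<in> sets M" "f \<in> borel_measurable M"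
    and "emeasure M L < \<infinity>" "K \<subseteq> L"
  shows "(LINT x:K|M. min 1 \<bar>f x :: real\<bar>) \<le> (LINT x:L|M. min 1 \<bar>f x\<bar>)"
proof -
  have L: "set_integrable M L (\<lambda>x. min 1 \<bar>f x\<bar>)"
    using assms by (intro set_integrable_trunc) auto
  then have "set_integrable M K (\<lambda>x. min 1 \<bar>f x\<bar>)"
    by (rule set_integrable_subset) (use assms in auto)
  from this L show ?thesis
    unfolding set_lebesgue_integral_def set_integrable_def
    by (rule integral_mono) (use \<open>K \<subseteq> L\<close> in \<open>auto simp: indicator_def\<close>)
qed

lemma L0_nhd_mono:
  assumes "K \<in> sets M" "L \<in> sets M" "emeasure M L < \<infinity>" "K \<subseteq> L" "\<delta> \<le> \<epsilon>"
  shows "L0_nhd M L \<delta> \<subseteq> L0_nhd M K \<epsilon>"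
proof
  fix F assume "F \<in> L0_nhd M L \<delta>"
  then obtain f where f: "F = ae_class M f" "f \<in> borel_measurable M"
    "(LINT x:L|M. min 1 \<bar>f x\<bar>) < \<delta>"
    by (auto simp: L0_nhd_def)
  moreover have "(LINT x:K|M. min 1 \<bar>f x\<bar>) \<le> (LINT x:L|M. min 1 \<bar>f x\<bar>)"
    using assms f by (intro set_integral_trunc_mono) auto
  ultimately show "F \<in> L0_nhd M K \<epsilon>"
    using \<open>\<delta> \<le> \<epsilon>\<close> unfolding L0_nhd_def by (intro CollectI exI[of _ f]) auto
qed

lemma istopology_L0_open: "istopology (L0_open M)"
  unfolding istopology_def
proof (intro conjI allI impI)
  fix S T assume S: "L0_open M S" and T: "L0_open M T"
  show "L0_open M (S \<inter> T)"
    unfolding L0_open_def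
  proof (intro conjI ballI)
    show "S \<inter> T \<subseteq> L0 M" using S by (auto simp: L0_open_def)
    fix F assume "F \<in> S \<inter> T"
    with S T obtain K L and \<delta> \<epsilon> :: real where *: "K \<in> sets M" "L \<in> sets M" "\<delta> > 0" "\<epsilon> > 0"
      "emeasure M K < \<infinity>" "emeasure M L < \<infinity>"
      "L0_add M F ` L0_nhd M K \<delta> \<subseteq> S" "L0_add M F ` L0_nhd M L \<epsilon> \<subseteq> T"
      unfolding L0_open_def by (metis IntD1 IntD2)
    have fin: "emeasure M (K \<union> L) < \<infinity>"
    proof -
      have "emeasure M (K \<union> L) \<le> emeasure M K + emeasure M L"
        using * by (intro emeasure_subadditive) auto
      also have "\<dots> < \<infinity>" using * by simp
      finally show ?thesis .
    qed
    have "L0_nhd M (K \<union> L) (min \<delta> \<epsilon>) \<subseteq> L0_nhd M K \<delta>" "L0_nhd M (K \<union> L) (min \<delta> \<epsilon>) \<subseteq> L0_nhd M L \<epsilon>"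
      by (rule L0_nhd_mono; use * fin in auto)+
    then have "L0_add M F ` L0_nhd M (K \<union> L) (min \<delta> \<epsilon>) \<subseteq> S \<inter> T"
      using * by blast
    then show "\<exists>K\<in>sets M. \<exists>\<epsilon>>0. emeasure M K < \<infinity> \<and> L0_add M F ` L0_nhd M K \<epsilon> \<subseteq> S \<inter> T"
      using * fin by (intro bexI[of _ "K \<union> L"] exI[of _ "min \<delta> \<epsilon>"]) auto
  qed
next
  fix \<K> assume *: "\<forall>U\<in>\<K>. L0_open M U"
  show "L0_open M (\<Union>\<K>)"
    unfolding L0_open_def
  proof (intro conjI ballI)
    show "\<Union>\<K> \<subseteq> L0 M" using * by (auto simp: L0_open_def)
    fix F assume "F \<in> \<Union>\<K>"
    then obtain U where U: "U \<in> \<K>" "F \<in> U" by blast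
    with * obtain K \<epsilon> where "K \<in> sets M" "\<epsilon> > 0" "emeasure M K < \<infinity>"
      "L0_add M F ` L0_nhd M K \<epsilon> \<subseteq> U"
      unfolding L0_open_def by metis
    with U show "\<exists>K\<in>sets M. \<exists>\<epsilon>>0. emeasure M K < \<infinity> \<and> L0_add M F ` L0_nhd M K \<epsilon> \<subseteq> \<Union>\<K>"
      by blast
  qed
qed

lemma openin_L0_topology: "openin (L0_topology M) = L0_open M"
  unfolding L0_topology_def by (rule topology_inverse'[OF istopology_L0_open])

lemma topspace_L0_topology: "topspace (L0_topology M) = L0 M"
proof
  show "topspace (L0_topology M) \<subseteq> L0 M"
    by (auto simp: topspace_def openin_L0_topology L0_open_def)
  have "L0_add M F ` L0_nhd M {} 1 \<subseteq> L0 M" if "F \<in> L0 M" for F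
    using that by (auto simp: L0_eq L0_nhd_def L0_add_class)
  then have "L0_open M (L0 M)"
    unfolding L0_open_def by (auto intro!: bexI[of _ "{}"] exI[of _ 1])
  then show "L0 M \<subseteq> topspace (L0_topology M)"
    by (auto simp: topspace_def openin_L0_topology)
qed

lemma topspace_L0_seqs: "topspace (vtop (L0_seqs M)) = UNIV \<rightarrow>\<^sub>E L0 M"
  by (simp add: L0_seqs_def topspace_L0_topology)

lemma set_integral_trunc_add:
  assumes [measurable]: "K \<in> sets M" "f \<in> borel_measurable M" "g \<in> borel_measurable M"
    and K: "emeasure M K < \<infinity>"
  shows "(LINT x:K|M. min 1 \<bar>f x + g x :: real\<bar>)
    \<le> (LINT x:K|M. min 1 \<bar>f x\<bar>) + (LINT x:K|M. min 1 \<bar>g x\<bar>)"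
proof -
  have "(LINT x:K|M. min 1 \<bar>f x + g x\<bar>) \<le> (LINT x:K|M. min 1 \<bar>f x\<bar> + min 1 \<bar>g x\<bar>)"
    using K by (intro set_integral_mono set_integral_add set_integrable_trunc) auto
  also have "\<dots> = (LINT x:K|M. min 1 \<bar>f x\<bar>) + (LINT x:K|M. min 1 \<bar>g x\<bar>)"
    using K by (intro set_integral_add set_integrable_trunc) auto
  finally show ?thesis .
qed

lemma openin_L0_nhd:
  assumes K: "K \<in> sets M" "emeasure M K < \<infinity>"
  shows "openin (L0_topology M) (L0_nhd M K \<epsilon>)"
  unfolding openin_L0_topology L0_open_def
proof (intro conjI ballI)
  show "L0_nhd M K \<epsilon> \<subseteq> L0 M" by (auto simp: L0_nhd_def L0_eq)
  fix F assume "F \<in> L0_nhd M K \<epsilon>"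
  then obtain f where f: "F = ae_class M f" and [measurable]: "f \<in> borel_measurable M"
    and less: "(LINT x:K|M. min 1 \<bar>f x\<bar>) < \<epsilon>"
    by (auto simp: L0_nhd_def)
  let ?\<delta> = "\<epsilon> - (LINT x:K|M. min 1 \<bar>f x\<bar>)"
  have "L0_add M F ` L0_nhd M K ?\<delta> \<subseteq> L0_nhd M K \<epsilon>"
  proof (rule image_subsetI)
    fix G assume "G \<in> L0_nhd M K ?\<delta>"
    then obtain g where g: "G = ae_class M g" and [measurable]: "g \<in> borel_measurable M"
      and "(LINT x:K|M. min 1 \<bar>g x\<bar>) < ?\<delta>"
      by (auto simp: L0_nhd_def)
    with set_integral_trunc_add[of K M f g] K
    have "(LINT x:K|M. min 1 \<bar>f x + g x\<bar>) < \<epsilon>" by simp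
    then show "L0_add M F G \<in> L0_nhd M K \<epsilon>"
      unfolding f g L0_nhd_def
      by (subst L0_add_class) (auto intro!: exI[of _ "\<lambda>x. f x + g x"])
  qed
  with less K show "\<exists>K'\<in>sets M. \<exists>\<delta>>0. emeasure M K' < \<infinity> \<and> L0_add M F ` L0_nhd M K' \<delta> \<subseteq> L0_nhd M K \<epsilon>"
    by (intro bexI[of _ K] exI[of _ ?\<delta>]) auto
qed

lemma L0_nhd_base:
  "(\<exists>U. openin (L0_topology M) U \<and> ae_class M (\<lambda>x. 0) \<in> U \<and> U \<subseteq> N) \<longleftrightarrow>
   (\<exists>K\<in>sets M. \<exists>\<epsilon>>0. emeasure M K < \<infinity> \<and> L0_nhd M K \<epsilon> \<subseteq> N)"
proof
  assume "\<exists>U. openin (L0_topology M) U \<and> ae_class M (\<lambda>x. 0) \<in> U \<and> U \<subseteq> N"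
  then obtain U where U: "L0_open M U" "ae_class M (\<lambda>x. 0) \<in> U" "U \<subseteq> N"
    by (auto simp: openin_L0_topology)
  then obtain K \<epsilon> where K: "K \<in> sets M" "\<epsilon> > 0" "emeasure M K < \<infinity>"
    and sub: "L0_add M (ae_class M (\<lambda>x. 0)) ` L0_nhd M K \<epsilon> \<subseteq> U"
    unfolding L0_open_def by metis
  have "L0_add M (ae_class M (\<lambda>x. 0)) F = F" if "F \<in> L0_nhd M K \<epsilon>" for F
    using that by (auto simp: L0_nhd_def L0_add_class)
  with sub have "L0_nhd M K \<epsilon> \<subseteq> U" by (metis image_subset_iff subsetI)
  with K U show "\<exists>K\<in>sets M. \<exists>\<epsilon>>0. emeasure M K < \<infinity> \<and> L0_nhd M K \<epsilon> \<subseteq> N" by blast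
next
  assume "\<exists>K\<in>sets M. \<exists>\<epsilon>>0. emeasure M K < \<infinity> \<and> L0_nhd M K \<epsilon> \<subseteq> N"
  then obtain K \<epsilon> where K: "K \<in> sets M" "\<epsilon> > 0" "emeasure M K < \<infinity>" "L0_nhd M K \<epsilon> \<subseteq> N"
    by blast
  have "ae_class M (\<lambda>x. 0) \<in> L0_nhd M K \<epsilon>"
    using K unfolding L0_nhd_def
    by (intro CollectI exI[of _ "\<lambda>x. 0"]) (auto simp: set_lebesgue_integral_def)
  with K openin_L0_nhd[of K M \<epsilon>]
  show "\<exists>U. openin (L0_topology M) U \<and> ae_class M (\<lambda>x. 0) \<in> U \<and> U \<subseteq> N" by blast
qed

section \<open>Sets of sequences converging to zero\<close>

text \<open>The sequences in \<open>L\<^sub>0\<close> having representatives with property \<open>P\<close>. None of the properties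
  used below depends on the choice of the representatives, see \<open>seq_class_in_iff\<close>.\<close>

definition seq_classes :: "'a measure \<Rightarrow> ((nat \<Rightarrow> 'a \<Rightarrow> real) \<Rightarrow> bool) \<Rightarrow> (nat \<Rightarrow> ('a \<Rightarrow> real) set) set"
  where "seq_classes M P = {(\<lambda>n. ae_class M (f n)) |f. (\<forall>n. f n \<in> borel_measurable M) \<and> P f}"

definition S_p :: "'a measure \<Rightarrow> (nat \<Rightarrow> ('a \<Rightarrow> real) set) set" where
  "S_p M = seq_classes M (\<lambda>f. AE x in M. (\<lambda>n. f n x) \<longlonglongrightarrow> 0)"

definition S_u :: "'a measure \<Rightarrow> (nat \<Rightarrow> ('a \<Rightarrow> real) set) set" where
  "S_u M = seq_classes M (\<lambda>f. \<exists>Z\<in>sets M. emeasure M Z = 0 \<and>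
     uniform_limit (space M - Z) f (\<lambda>x. 0) sequentially)"

definition S_au :: "'a measure \<Rightarrow> (nat \<Rightarrow> ('a \<Rightarrow> real) set) set" where
  "S_au M = seq_classes M (\<lambda>f. \<forall>\<epsilon>>0::real. \<exists>Z\<in>sets M. emeasure M Z < ennreal \<epsilon> \<and>
     uniform_limit (space M - Z) f (\<lambda>x. 0) sequentially)"

definition S_m :: "'a measure \<Rightarrow> (nat \<Rightarrow> ('a \<Rightarrow> real) set) set" where
  "S_m M = seq_classes M (\<lambda>f. \<forall>\<epsilon>>0.
     (\<lambda>n. emeasure M {x \<in> space M. \<bar>f n x\<bar> > \<epsilon>}) \<longlonglongrightarrow> 0)"

definition S_c :: "'a measure \<Rightarrow> (nat \<Rightarrow> ('a \<Rightarrow> real) set) set" where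
  "S_c M = seq_classes M (\<lambda>f. \<forall>\<epsilon>>0.
     (\<Sum>n. emeasure M {x \<in> space M. \<bar>f n x\<bar> > \<epsilon>}) < \<infinity>)"

lemma seq_class_mem_seq_classes:
  assumes f: "\<And>n. f n \<in> borel_measurable M"
    and P: "\<And>g h Z. \<lbrakk>\<And>n. g n \<in> borel_measurable M; \<And>n. h n \<in> borel_measurable M; Z \<in> null_sets M;
              \<And>n x. x \<in> space M - Z \<Longrightarrow> h n x = g n x; P g\<rbrakk> \<Longrightarrow> P h"
  shows "(\<lambda>n. ae_class M (f n)) \<in> seq_classes M P \<longleftrightarrow> P f"
proof
  assume "P f"
  with f show "(\<lambda>n. ae_class M (f n)) \<in> seq_classes M P" by (auto simp: seq_classes_def)
next
  assume "(\<lambda>n. ae_class M (f n)) \<in> seq_classes M P"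
  then obtain g where g: "\<And>n. g n \<in> borel_measurable M" "P g"
    and "(\<lambda>n. ae_class M (f n)) = (\<lambda>n. ae_class M (g n))"
    by (auto simp: seq_classes_def)
  then have "\<forall>n. AE x in M. f n x = g n x"
    using f by (metis ae_class_eq_iff)
  then have "AE x in M. \<forall>n. f n x = g n x" by (simp add: AE_all_countable)
  then obtain Z where "Z \<in> null_sets M" "{x \<in> space M. \<not> (\<forall>n. f n x = g n x)} \<subseteq> Z"
    by (auto simp: eventually_ae_filter)
  then show "P f" using g f by (intro P[of g f Z]) auto
qed

lemma emeasure_gt_cong:
  assumes [measurable]: "f \<in> borel_measurable M" "g \<in> borel_measurable M"
    and Z: "Z \<in> null_sets M" "\<And>x. x \<in> space M - Z \<Longrightarrow> f x = g x"
  shows "emeasure M {x \<in> space M. \<bar>f x :: real\<bar> > \<epsilon>} = emeasure M {x \<in> space M. \<bar>g x\<bar> > \<epsilon>}"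
proof (rule emeasure_eq_AE)
  have "AE x in M. x \<notin> Z" using Z by (rule_tac AE_not_in)
  then show "AE x in M. x \<in> {x \<in> space M. \<bar>f x\<bar> > \<epsilon>} \<longleftrightarrow> x \<in> {x \<in> space M. \<bar>g x\<bar> > \<epsilon>}"
    by eventually_elim (use Z in auto)
qed auto

lemma seq_class_in_iff:
  assumes f: "\<And>n. f n \<in> borel_measurable M"
  shows "(\<lambda>n. ae_class M (f n)) \<in> S_p M \<longleftrightarrow> (AE x in M. (\<lambda>n. f n x) \<longlonglongrightarrow> 0)" (is ?p)
    and "(\<lambda>n. ae_class M (f n)) \<in> S_u M \<longleftrightarrow> (\<exists>Z\<in>sets M. emeasure M Z = 0 \<and>
      uniform_limit (space M - Z) f (\<lambda>x. 0) sequentially)" (is ?u)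
    and "(\<lambda>n. ae_class M (f n)) \<in> S_au M \<longleftrightarrow> (\<forall>\<epsilon>>0::real. \<exists>Z\<in>sets M. emeasure M Z < ennreal \<epsilon> \<and>
      uniform_limit (space M - Z) f (\<lambda>x. 0) sequentially)" (is ?au)
    and "(\<lambda>n. ae_class M (f n)) \<in> S_m M \<longleftrightarrow> (\<forall>\<epsilon>>0.
      (\<lambda>n. emeasure M {x \<in> space M. \<bar>f n x\<bar> > \<epsilon>}) \<longlonglongrightarrow> 0)" (is ?m)
    and "(\<lambda>n. ae_class M (f n)) \<in> S_c M \<longleftrightarrow> (\<forall>\<epsilon>>0.
      (\<Sum>n. emeasure M {x \<in> space M. \<bar>f n x\<bar> > \<epsilon>}) < \<infinity>)" (is ?c)
proof -
  have unif: "\<exists>Y'\<in>sets M. emeasure M Y' = emeasure M Y \<and>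
      uniform_limit (space M - Y') h (\<lambda>x. 0) sequentially"
    if "Y \<in> sets M" "uniform_limit (space M - Y) g (\<lambda>x. 0) sequentially"
      "Z \<in> null_sets M" "\<And>n x. x \<in> space M - Z \<Longrightarrow> h n x = g n x"
    for Y Z and g h :: "nat \<Rightarrow> 'a \<Rightarrow> real"
  proof (intro bexI conjI)
    show "Y \<union> Z \<in> sets M" using that by auto
    show "emeasure M (Y \<union> Z) = emeasure M Y" using that by (simp add: emeasure_Un_null_set)
    have "uniform_limit (space M - (Y \<union> Z)) g (\<lambda>x. 0) sequentially"
      using that(2) by (rule uniform_limit_on_subset) auto
    then show "uniform_limit (space M - (Y \<union> Z)) h (\<lambda>x. 0) sequentially"
      by (rule uniform_limit_cong'[THEN iffD1, rotated 2]) (use that in auto)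
  qed
  show ?p unfolding S_p_def
  proof (rule seq_class_mem_seq_classes[OF f])
    fix g h :: "nat \<Rightarrow> 'a \<Rightarrow> real" and Z
    assume "Z \<in> null_sets M" and eq: "\<And>n x. x \<in> space M - Z \<Longrightarrow> h n x = g n x"
      and lim: "AE x in M. (\<lambda>n. g n x) \<longlonglongrightarrow> 0"
    have "AE x in M. x \<notin> Z" by (rule AE_not_in) fact
    with lim AE_space show "AE x in M. (\<lambda>n. h n x) \<longlonglongrightarrow> 0"
      by eventually_elim (use eq in simp)
  qed
  show ?u unfolding S_u_def
    by (rule seq_class_mem_seq_classes[OF f]) (metis unif)
  show ?au unfolding S_au_def
    by (rule seq_class_mem_seq_classes[OF f]) (metis unif)
  show ?m unfolding S_m_def
  proof (rule seq_class_mem_seq_classes[OF f])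
    fix g h :: "nat \<Rightarrow> 'a \<Rightarrow> real" and Z
    assume *: "\<And>n. g n \<in> borel_measurable M" "\<And>n. h n \<in> borel_measurable M" "Z \<in> null_sets M"
      "\<And>n x. x \<in> space M - Z \<Longrightarrow> h n x = g n x"
      and lim: "\<forall>\<epsilon>>0. (\<lambda>n. emeasure M {x \<in> space M. \<bar>g n x\<bar> > \<epsilon>}) \<longlonglongrightarrow> 0"
    have "emeasure M {x \<in> space M. \<bar>h n x\<bar> > \<epsilon>} = emeasure M {x \<in> space M. \<bar>g n x\<bar> > \<epsilon>}" for n \<epsilon>
      using * by (intro emeasure_gt_cong[of _ _ _ Z]) auto
    with lim show "\<forall>\<epsilon>>0. (\<lambda>n. emeasure M {x \<in> space M. \<bar>h n x\<bar> > \<epsilon>}) \<longlonglongrightarrow> 0" by simp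
  qed
  show ?c unfolding S_c_def
  proof (rule seq_class_mem_seq_classes[OF f])
    fix g h :: "nat \<Rightarrow> 'a \<Rightarrow> real" and Z
    assume *: "\<And>n. g n \<in> borel_measurable M" "\<And>n. h n \<in> borel_measurable M" "Z \<in> null_sets M"
      "\<And>n x. x \<in> space M - Z \<Longrightarrow> h n x = g n x"
      and lim: "\<forall>\<epsilon>>0. (\<Sum>n. emeasure M {x \<in> space M. \<bar>g n x\<bar> > \<epsilon>}) < \<infinity>"
    have "emeasure M {x \<in> space M. \<bar>h n x\<bar> > \<epsilon>} = emeasure M {x \<in> space M. \<bar>g n x\<bar> > \<epsilon>}" for n \<epsilon>
      using * by (intro emeasure_gt_cong[of _ _ _ Z]) auto
    with lim show "\<forall>\<epsilon>>0. (\<Sum>n. emeasure M {x \<in> space M. \<bar>h n x\<bar> > \<epsilon>}) < \<infinity>" by simp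
  qed
qed

end

(* For every k choose a typewriter sequence of indicators of sets of positive measure tending to
   zero that sweeps infinitely often over almost every point of a fixed set A with
   0 < mu(A) < oo, and interleave these sequences to a single sequence (E_n), where the index n
   belongs to the sequence number kappa(n). The required subspace consists of all sequences
   (c(kappa(n)) 1_{E_n})_n with c an arbitrary real sequence. Since at each index only one of the
   typewriter sequences is active, convergence in measure is automatic, and if c(k) is nonzero,
   the values at almost every point of A have modulus |c(k)| infinitely often. The subspace is
   closed because each E_n has positive finite measure, so that the coefficients of an
   approximating net converge. *)

theory Submission
  imports Defs
begin

section \<open>Typewriter sequences\<close>

text \<open>Without atoms, a set of positive measure splits into two sets of positive measure, and
  the smaller of them carries at most half of the measure. Iterating this \<open>n\<close> times
  leaves a set of positive measure at most \<mu>(B) / 2^n.\<close>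

lemma nonatomic_small_subset:
  assumes M: "nonatomic M" and B: "B \<in> sets M" "0 < emeasure M B" "emeasure M B < \<infinity>"
    and \<delta>: "0 < (\<delta>::real)"
  shows "\<exists>C\<in>sets M. C \<subseteq> B \<and> 0 < emeasure M C \<and> emeasure M C \<le> ennreal \<delta>"
proof -
  have halving: "\<exists>C\<in>sets M. C \<subseteq> B \<and> 0 < emeasure M C \<and> 2 ^ n * emeasure M C \<le> emeasure M B" for n :: nat
  proof (induction n)
    case 0
    then show ?case using B by auto
  next
    case (Suc n)
    then obtain C where C: "C \<in> sets M" "C \<subseteq> B" "0 < emeasure M C"
      "2 ^ n * emeasure M C \<le> emeasure M B" by blast
    with M obtain D1 D2 where D: "D1 \<in> sets M" "D2 \<in> sets M" "D1 \<inter> D2 = {}" "D1 \<union> D2 = C"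
      "0 < emeasure M D1" "0 < emeasure M D2"
      unfolding nonatomic_def measure_atom_def by blast
    then have sum: "emeasure M D1 + emeasure M D2 = emeasure M C"
      using plus_emeasure by metis
    obtain D where D': "D \<in> sets M" "D \<subseteq> C" "0 < emeasure M D" "2 * emeasure M D \<le> emeasure M C"
    proof (cases "emeasure M D1 \<le> emeasure M D2")
      case True
      then have "2 * emeasure M D1 \<le> emeasure M C"
        unfolding sum[symmetric] mult_2 by (rule add_left_mono)
      then show ?thesis using D that by blast
    next
      case False
      then have "2 * emeasure M D2 \<le> emeasure M C"
        unfolding sum[symmetric] mult_2 by (intro add_right_mono) auto
      then show ?thesis using D that by blast
    qed
    have "2 ^ Suc n * emeasure M D = 2 ^ n * (2 * emeasure M D)"
      by (simp add: ac_simps)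
    also have "\<dots> \<le> 2 ^ n * emeasure M C"
      using D' by (intro mult_left_mono) auto
    finally show ?case using C D' by (intro bexI[of _ D]) auto
  qed
  obtain b where b: "emeasure M B = ennreal b" "0 \<le> b"
    using B(3) by (cases "emeasure M B") auto
  obtain n where n: "b / \<delta> < 2 ^ n"
    using real_arch_pow[of 2 "b / \<delta>"] by auto
  obtain C where C: "C \<in> sets M" "C \<subseteq> B" "0 < emeasure M C" "2 ^ n * emeasure M C \<le> emeasure M B"
    using halving by blast
  have "emeasure M C \<le> emeasure M B" using B C by (intro emeasure_mono)
  with b obtain c where c: "emeasure M C = ennreal c" "0 \<le> c"
    by (cases "emeasure M C") (auto simp: top_unique)
  have "ennreal (2 ^ n * c) = 2 ^ n * emeasure M C"
    using c by (simp add: ennreal_mult ennreal_power[symmetric])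
  with C(4) b c have "2 ^ n * c \<le> b" by (metis ennreal_le_iff)
  also have "b \<le> 2 ^ n * \<delta>" using n \<delta> by (simp add: field_simps)
  finally have "c \<le> \<delta>" by simp
  with C c show ?thesis by (auto intro!: bexI[of _ C] ennreal_leI)
qed

text \<open>Exhaustion: a countable union of small subsets of \<open>A\<close> of maximal measure must fill \<open>A\<close>,
  for otherwise a small subset of positive measure of the rest could be added to it.\<close>

lemma nonatomic_countable_partition:
  assumes M: "nonatomic M" and A: "A \<in> sets M" "emeasure M A < \<infinity>" and \<delta>: "0 < (\<delta>::real)"
  shows "\<exists>D::nat \<Rightarrow> 'a set. range D \<subseteq> sets M \<and> disjoint_family D \<and> (\<forall>i. D i \<subseteq> A) \<and>
    (\<forall>i. emeasure M (D i) \<le> ennreal \<delta>) \<and> A - (\<Union>i. D i) \<in> null_sets M"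
proof -
  let ?small = "{B \<in> sets M. B \<subseteq> A \<and> emeasure M B \<le> ennreal \<delta>}"
  \<comment> \<open>Countable unions of small sets are closed under countable unions, which is why
    the supremum of their measures is attained.\<close>
  define \<C> where "\<C> = {\<Union>i::nat. B i |B. range B \<subseteq> ?small}"
  have \<C>_sub: "U \<in> sets M \<and> U \<subseteq> A" if "U \<in> \<C>" for U
    using that unfolding \<C>_def by blast
  have UN: "(\<Union>n::nat. U n) \<in> \<C>" if "range U \<subseteq> \<C>" for U
  proof -
    have "\<forall>n. \<exists>B. U n = (\<Union>i::nat. B i) \<and> range B \<subseteq> ?small"
      using that unfolding \<C>_def by blast
    then obtain B where B: "\<And>n. U n = (\<Union>i::nat. B n i)" "\<And>n. range (B n) \<subseteq> ?small"
      by metis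
    \<comment> \<open>A double sequence of small sets is listed as a single one through the pairing
      function.\<close>
    define B' where "B' m = (case prod_decode m of (n, i) \<Rightarrow> B n i)" for m
    have "(\<Union>n. U n) = (\<Union>m. B' m)"
    proof (intro equalityI subsetI)
      fix x assume "x \<in> (\<Union>n. U n)"
      then obtain n i where "x \<in> B n i" using B(1) by blast
      then have "x \<in> B' (prod_encode (n, i))" by (simp add: B'_def)
      then show "x \<in> (\<Union>m. B' m)" by blast
    next
      fix x assume "x \<in> (\<Union>m. B' m)"
      then obtain m where "x \<in> B' m" by blast
      then show "x \<in> (\<Union>n. U n)"
        using B(1) by (cases "prod_decode m") (auto simp: B'_def)
    qed
    moreover have "range B' \<subseteq> ?small"
      using B(2) by (auto simp: B'_def image_subset_iff split: prod.splits)
    ultimately show ?thesis unfolding \<C>_def by blast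
  qed
  have "{} \<in> \<C>" unfolding \<C>_def by (auto intro!: exI[of _ "\<lambda>_. {}"])
  then have "\<C> \<noteq> {}" by blast
  then have "emeasure M ` \<C> \<noteq> {}" by blast
  from ennreal_Sup_countable_SUP[OF this]
  obtain s :: "nat \<Rightarrow> ennreal" where s: "range s \<subseteq> emeasure M ` \<C>" "(SUP U\<in>\<C>. emeasure M U) = (SUP i. s i)"
    by auto
  then have "\<forall>i. \<exists>U. U \<in> \<C> \<and> s i = emeasure M U" by (auto simp: image_iff subset_iff)
  then obtain U where U: "\<And>i. U i \<in> \<C>" "\<And>i. s i = emeasure M (U i)" by metis
  \<comment> \<open>The union of a maximizing sequence lies in \<open>\<C>\<close> and dominates
    each of its members, so it attains the supremum.\<close>
  define W where "W = (\<Union>i. U i)"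
  have W: "W \<in> \<C>" using UN[of U] U by (auto simp: W_def)
  have W_max: "emeasure M X \<le> emeasure M W" if "X \<in> \<C>" for X
  proof -
    have "emeasure M X \<le> (SUP i. s i)" using s(2) that by (metis SUP_upper)
    also have "\<dots> \<le> emeasure M W"
    proof (rule SUP_least)
      fix i show "s i \<le> emeasure M W"
        unfolding U(2) using \<C>_sub[OF W] by (intro emeasure_mono) (auto simp: W_def)
    qed
    finally show ?thesis .
  qed
  have Wfin: "emeasure M W < \<infinity>"
    using emeasure_mono[of W A M] \<C>_sub[OF W] A by (auto intro: le_less_trans)
  have null: "A - W \<in> null_sets M"
  proof (rule ccontr)
    assume "A - W \<notin> null_sets M"
    then have pos: "0 < emeasure M (A - W)"
      using A \<C>_sub[OF W] by (auto simp: null_sets_def zero_less_iff_neq_zero)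
    have "emeasure M (A - W) < \<infinity>"
      using emeasure_mono[of "A - W" A M] A by (auto intro: le_less_trans)
    with pos obtain C where C: "C \<in> sets M" "C \<subseteq> A - W" "0 < emeasure M C" "emeasure M C \<le> ennreal \<delta>"
      using nonatomic_small_subset[OF M _ _ _ \<delta>] A \<C>_sub[OF W] by blast
    then have "C \<in> \<C>" unfolding \<C>_def by (auto intro!: exI[of _ "\<lambda>_. C"])
    then have "(\<Union>n::nat. if n = 0 then C else W) \<in> \<C>"
      using W by (intro UN) auto
    also have "(\<Union>n::nat. if n = 0 then C else W) = W \<union> C"
      by (auto split: if_splits)
    finally have "emeasure M (W \<union> C) \<le> emeasure M W" by (rule W_max)
    moreover have "emeasure M (W \<union> C) = emeasure M W + emeasure M C"
      using C \<C>_sub[OF W] by (intro plus_emeasure[symmetric]) auto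
    \<comment> \<open>Cancelling the measure of \<open>W\<close> is legitimate because it is
      finite.\<close>
    ultimately show False using C(3) Wfin
      by (metis add.right_neutral ennreal_add_left_cancel_le infinity_ennreal_def leD)
  qed
  obtain B where B: "W = (\<Union>i::nat. B i)" "range B \<subseteq> ?small"
    using W unfolding \<C>_def by blast
  have sub: "disjointed B i \<subseteq> B i" for i by (rule disjointed_subset)
  have sets: "range (disjointed B) \<subseteq> sets M"
    using B(2) by (intro sets.range_disjointed_sets) auto
  have "emeasure M (disjointed B i) \<le> ennreal \<delta>" for i
    using emeasure_mono[OF sub, of i M] B(2) by (auto simp: image_subset_iff intro: order_trans)
  moreover have "disjointed B i \<subseteq> A" for i using sub B(2) by blast
  moreover have "A - (\<Union>i. disjointed B i) \<in> null_sets M"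
    using null by (simp add: UN_disjointed_eq B(1))
  ultimately show ?thesis
    using sets disjoint_family_disjointed by blast
qed
text \<open>The measures of disjoint pieces of a set of finite measure form a convergent series, so
  they tend to zero.\<close>

lemma finite_ge_of_disjoint_family:
  fixes D :: "nat \<Rightarrow> 'a set"
  assumes D: "range D \<subseteq> sets M" "disjoint_family D" "\<And>i. D i \<subseteq> A"
    and A: "A \<in> sets M" "emeasure M A < \<infinity>" and e: "0 < e"
  shows "finite {i. e \<le> emeasure M (D i)}"
proof -
  have sets: "D i \<in> sets M" for i using D(1) by auto
  have "emeasure M (D i) \<noteq> \<infinity>" for i
    using emeasure_mono[OF D(3) A(1), of i] A(2) by (auto simp: top_unique)
  then have eq: "emeasure M (D i) = ennreal (measure M (D i))" for i
    by (simp add: emeasure_eq_ennreal_measure)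
  have "(\<Sum>i. ennreal (measure M (D i))) = emeasure M (\<Union>i. D i)"
    unfolding eq[symmetric] using D by (intro suminf_emeasure)
  also have "\<dots> \<le> emeasure M A" using D A by (intro emeasure_mono) auto
  finally have "(\<Sum>i. ennreal (measure M (D i))) \<noteq> top" using A by (auto simp: top_unique)
  then have "summable (\<lambda>i. measure M (D i))"
    by (rule summable_suminf_not_top[rotated]) simp
  then have "(\<lambda>i. measure M (D i)) \<longlonglongrightarrow> 0" by (rule summable_LIMSEQ_zero)
  then have "(\<lambda>i. emeasure M (D i)) \<longlonglongrightarrow> 0"
    unfolding eq by (metis ennreal_0 tendsto_ennrealI)
  then have "eventually (\<lambda>i. emeasure M (D i) < e) sequentially"
    using e by (rule order_tendstoD)
  then show ?thesis
    by (simp add: cofinite_eq_sequentially[symmetric] eventually_cofinite not_less)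
qed

section \<open>Construction and enumeration of the typewriter sets\<close>

lemma semifinite_obtain_finite:
  assumes "semifinite M" and "0 < emeasure M (space M)"
  obtains A where "A \<in> sets M" "0 < emeasure M A" "emeasure M A < \<infinity>"
proof -
  have "0 < (SUP B\<in>{B \<in> sets M. B \<subseteq> space M \<and> emeasure M B < \<infinity>}. emeasure M B)"
    using assms unfolding semifinite_def by (metis sets.top)
  then show ?thesis unfolding less_SUP_iff using that by blast
qed

text \<open>The index set consists of the triples \<open>(j, k, i)\<close> with \<open>k \<le> j\<close>, standing for the
  \<open>i\<close>-th piece of a partition of \<open>A\<close> into pieces of measure at most \<open>1 / (j + 1)\<close>, used for the
  \<open>k\<close>-th typewriter sequence. Only finitely many of them have measure at least a given
  \<open>e > 0\<close>, so the measures tend to zero along any enumeration.\<close>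

lemma typewriter_sequences:
  fixes M :: "'a measure"
  assumes pos: "0 < emeasure M (space M)" and na: "nonatomic M" and sf: "semifinite M"
  obtains A and E :: "nat \<Rightarrow> 'a set" and \<kappa> :: "nat \<Rightarrow> nat"
  where "A \<in> sets M" "0 < emeasure M A"
    and "\<And>n. E n \<in> sets M" "\<And>n. 0 < emeasure M (E n)" "\<And>n. emeasure M (E n) < \<infinity>"
    and "(\<lambda>n. emeasure M (E n)) \<longlonglongrightarrow> 0"
    and "\<And>k. AE x in M. x \<in> A \<longrightarrow> infinite {n. \<kappa> n = k \<and> x \<in> E n}"
proof -
  obtain A where A: "A \<in> sets M" "0 < emeasure M A" "emeasure M A < \<infinity>"
    using semifinite_obtain_finite[OF sf pos] by blast
  have "\<forall>j. \<exists>D::nat \<Rightarrow> 'a set. range D \<subseteq> sets M \<and> disjoint_family D \<and> (\<forall>i. D i \<subseteq> A) \<and>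
      (\<forall>i. emeasure M (D i) \<le> ennreal (1 / Suc j)) \<and> A - (\<Union>i. D i) \<in> null_sets M"
    by (intro allI nonatomic_countable_partition na A) simp
  then obtain D :: "nat \<Rightarrow> nat \<Rightarrow> 'a set" where D: "\<And>j. range (D j) \<subseteq> sets M"
      "\<And>j. disjoint_family (D j)" "\<And>j i. D j i \<subseteq> A"
      "\<And>j i. emeasure M (D j i) \<le> ennreal (1 / Suc j)" "\<And>j. A - (\<Union>i. D j i) \<in> null_sets M"
    by metis
  have Dsets: "D j i \<in> sets M" for j i using D(1) by blast
  \<comment> \<open>Null pieces are discarded, so that every \<open>E n\<close> will have positive
    measure. The bound \<open>k \<le> j\<close> leaves finitely many \<open>k\<close> for each
    \<open>j\<close>, yet gives the \<open>k\<close>-th typewriter sequence all levels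
    \<open>j \<ge> k\<close>.\<close>
  define I where "I = {(j, k, i). k \<le> j \<and> 0 < emeasure M (D j i)}"
  have cover: "AE x in M. x \<in> A \<longrightarrow> (\<forall>j. \<exists>i. x \<in> D j i \<and> 0 < emeasure M (D j i))"
  proof -
    have "AE x in M. x \<notin> A - (\<Union>i. D j i)" for j using D(5) by (rule AE_not_in)
    then have 1: "AE x in M. \<forall>j. x \<notin> A - (\<Union>i. D j i)" by (subst AE_all_countable) blast
    have "AE x in M. emeasure M (D j i) = 0 \<longrightarrow> x \<notin> D j i" for j i
      using Dsets[of j i] by (cases "emeasure M (D j i) = 0") (auto intro!: AE_not_in null_setsI)
    then have "AE x in M. \<forall>j i. emeasure M (D j i) = 0 \<longrightarrow> x \<notin> D j i"
      by (simp add: AE_all_countable)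
    with 1 show ?thesis
      by eventually_elim (metis DiffI UN_iff zero_less_iff_neq_zero)
  qed
  \<comment> \<open>Such a point shows that every level \<open>j\<close> has a piece of positive
    measure, so \<open>I\<close> is infinite and can be enumerated bijectively by the natural
    numbers.\<close>
  have "\<exists>x. x \<in> A \<and> (\<forall>j. \<exists>i. x \<in> D j i \<and> 0 < emeasure M (D j i))"
  proof (rule ccontr)
    assume none: "\<not> ?thesis"
    from cover have "AE x in M. x \<notin> A" by eventually_elim (use none in blast)
    then show False using A AE_iff_null_sets[of A M] by (auto simp: null_sets_def)
  qed
  then have "\<forall>j. \<exists>i. 0 < emeasure M (D j i)" by blast
  then have "range (\<lambda>j::nat. j) \<subseteq> fst ` I" by (force simp: I_def)
  then have "infinite I" using finite_subset infinite_UNIV_nat by fastforce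
  then have bij: "bij_betw (from_nat_into I) UNIV I" by (intro bij_betw_from_nat_into) auto
  define \<sigma> where "\<sigma> = from_nat_into I"
  have \<sigma>: "inj \<sigma>" "range \<sigma> = I" using bij by (auto simp: \<sigma>_def bij_betw_def)
  define E where "E n = (case \<sigma> n of (j, k, i) \<Rightarrow> D j i)" for n
  define \<kappa> where "\<kappa> n = fst (snd (\<sigma> n))" for n
  have E_ex: "\<exists>j i. E n = D j i \<and> 0 < emeasure M (D j i)" for n
  proof -
    have "\<sigma> n \<in> I" using \<sigma>(2) by blast
    then obtain j k i where "\<sigma> n = (j, k, i)" "0 < emeasure M (D j i)" unfolding I_def by blast
    then show ?thesis unfolding E_def by auto
  qed
  have E: "E n \<in> sets M" "0 < emeasure M (E n)" "E n \<subseteq> A" for n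
    using E_ex[of n] Dsets D(3) by (metis)+
  have Efin: "emeasure M (E n) < \<infinity>" for n
    using emeasure_mono[OF E(3) A(1), of n] A(3) by (rule le_less_trans)
  have lim: "(\<lambda>n. emeasure M (E n)) \<longlonglongrightarrow> 0"
  proof (rule order_tendstoI)
    fix e :: ennreal assume e: "0 < e"
    obtain e' where e': "0 < e'" "ennreal e' < e"
    proof (cases e)
      case (real r)
      then show ?thesis using e that[of "r / 2"] by (auto simp: ennreal_less_iff)
    qed (use that[of 1] in auto)
    obtain J :: nat where J: "1 / Suc J < e'" using nat_approx_posE[OF e'(1)] by (metis of_nat_Suc)
    have small: "emeasure M (D j i) < e" if "J \<le> j" for j i
    proof -
      have "emeasure M (D j i) \<le> ennreal (1 / Suc j)" by (rule D)
      also have "\<dots> \<le> ennreal (1 / Suc J)" using that by (intro ennreal_leI) (simp add: field_simps)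
      also have "\<dots> \<le> ennreal e'" using J by (intro ennreal_leI) simp
      also have "\<dots> < e" by (rule e')
      finally show ?thesis .
    qed
    \<comment> \<open>Pieces of level at least \<open>J\<close> are too small to count, and each of
      the finitely many earlier levels has only finitely many pieces of measure at least
      \<open>e\<close>. Injectivity of \<open>\<sigma>\<close> carries this finiteness over to the
      indices \<open>n\<close>.\<close>
    have "{n. \<not> emeasure M (E n) < e}
      \<subseteq> \<sigma> -` (SIGMA j:{..<J}. {..j} \<times> {i. e \<le> emeasure M (D j i)})" (is "_ \<subseteq> \<sigma> -` ?S")
    proof
      fix n assume n: "n \<in> {n. \<not> emeasure M (E n) < e}"
      obtain j k i where jki: "\<sigma> n = (j, k, i)" by (metis prod_cases3)
      moreover from this have "k \<le> j"
        using \<sigma>(2) unfolding I_def by (metis (mono_tags, lifting) case_prodD mem_Collect_eq rangeI)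
      moreover have "E n = D j i" using jki by (simp add: E_def)
      ultimately show "n \<in> \<sigma> -` ?S" using n small[of j i] by (auto simp: not_less not_le[symmetric])
    qed
    moreover have "finite ?S"
      by (intro finite_SigmaI finite_cartesian_product finite_ge_of_disjoint_family[OF D(1-3) A(1,3) e]) auto
    ultimately have "finite {n. \<not> emeasure M (E n) < e}"
      using finite_vimageI[OF _ \<sigma>(1)] finite_subset by blast
    then show "eventually (\<lambda>n. emeasure M (E n) < e) sequentially"
      by (simp add: cofinite_eq_sequentially[symmetric] eventually_cofinite)
  qed auto
  have "AE x in M. x \<in> A \<longrightarrow> infinite {n. \<kappa> n = k \<and> x \<in> E n}" for k
    using cover
  proof eventually_elim
    case (elim x)
    show ?case
    proof
      assume "x \<in> A"
      \<comment> \<open>At every level \<open>j \<ge> k\<close> some retained piece contains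
        \<open>x\<close>; distinct levels give distinct indices.\<close>
      have "{k..} \<subseteq> (fst \<circ> \<sigma>) ` {n. \<kappa> n = k \<and> x \<in> E n}"
      proof
        fix j assume "j \<in> {k..}"
        moreover obtain i where i: "x \<in> D j i" "0 < emeasure M (D j i)"
          using elim \<open>x \<in> A\<close> by blast
        ultimately have "(j, k, i) \<in> range \<sigma>" unfolding \<sigma>(2) by (simp add: I_def)
        then obtain n where "\<sigma> n = (j, k, i)" by (metis imageE)
        then show "j \<in> (fst \<circ> \<sigma>) ` {n. \<kappa> n = k \<and> x \<in> E n}"
          using i by (intro image_eqI[of _ _ n]) (auto simp: E_def \<kappa>_def)
      qed
      then show "infinite {n. \<kappa> n = k \<and> x \<in> E n}"
        using finite_subset infinite_Ici by blast
    qed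
  qed
  then show ?thesis using that[of A E \<kappa>] A E Efin lim by blast
qed

section \<open>Approximation by multiples of an indicator function\<close>

text \<open>For measurable \<open>f\<close> this is the translate of
  \<open>L0_nhd M K \<epsilon>\<close> by the class of \<open>f\<close>, written with the difference
  of representatives to avoid \<open>L0_add\<close>.\<close>

definition L0_ball :: "'a measure \<Rightarrow> 'a set \<Rightarrow> real \<Rightarrow> ('a \<Rightarrow> real) \<Rightarrow> ('a \<Rightarrow> real) set set" where
  "L0_ball M K \<epsilon> f = {ae_class M g |g. g \<in> borel_measurable M \<and> (LINT x:K|M. min 1 \<bar>g x - f x\<bar>) < \<epsilon>}"

lemma class_in_L0_ball_iff:
  assumes K: "K \<in> sets M" and f: "f \<in> borel_measurable M" and h: "h \<in> borel_measurable M"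
  shows "ae_class M h \<in> L0_ball M K \<epsilon> f \<longleftrightarrow> (LINT x:K|M. min 1 \<bar>h x - f x\<bar>) < \<epsilon>"
proof
  assume "ae_class M h \<in> L0_ball M K \<epsilon> f"
  then obtain g where g: "g \<in> borel_measurable M" "(LINT x:K|M. min 1 \<bar>g x - f x\<bar>) < \<epsilon>"
    "ae_class M h = ae_class M g" by (auto simp: L0_ball_def)
  then have ae: "AE x in M. h x = g x" using h ae_class_eq_iff by blast
  have "(LINT x:K|M. min 1 \<bar>h x - f x\<bar>) = (LINT x:K|M. min 1 \<bar>g x - f x\<bar>)"
    unfolding set_lebesgue_integral_def
  proof (rule integral_cong_AE)
    show "AE x in M. indicator K x *\<^sub>R min 1 \<bar>h x - f x\<bar> = indicator K x *\<^sub>R min 1 \<bar>g x - f x\<bar>"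
      using ae by eventually_elim simp
  qed (use K f h g in measurable)
  with g show "(LINT x:K|M. min 1 \<bar>h x - f x\<bar>) < \<epsilon>" by simp
qed (use h in \<open>auto simp: L0_ball_def\<close>)

text \<open>By the triangle inequality for the truncated integral, the distance still left up to
  \<open>\<epsilon>\<close> is an admissible radius around each point of the ball.\<close>

lemma openin_L0_ball:
  assumes K: "K \<in> sets M" "emeasure M K < \<infinity>" and f [measurable]: "f \<in> borel_measurable M"
  shows "openin (L0_topology M) (L0_ball M K \<epsilon> f)"
  unfolding openin_L0_topology L0_open_def
proof (intro conjI ballI)
  show "L0_ball M K \<epsilon> f \<subseteq> L0 M" by (auto simp: L0_ball_def L0_eq)
  fix H assume "H \<in> L0_ball M K \<epsilon> f"
  then obtain h where h: "H = ae_class M h" and [measurable]: "h \<in> borel_measurable M"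
    and less: "(LINT x:K|M. min 1 \<bar>h x - f x\<bar>) < \<epsilon>"
    by (auto simp: L0_ball_def)
  let ?\<delta> = "\<epsilon> - (LINT x:K|M. min 1 \<bar>h x - f x\<bar>)"
  have "L0_add M H ` L0_nhd M K ?\<delta> \<subseteq> L0_ball M K \<epsilon> f"
  proof (rule image_subsetI)
    fix G assume "G \<in> L0_nhd M K ?\<delta>"
    then obtain g where g: "G = ae_class M g" and [measurable]: "g \<in> borel_measurable M"
      and less': "(LINT x:K|M. min 1 \<bar>g x\<bar>) < ?\<delta>"
      by (auto simp: L0_nhd_def)
    have "(LINT x:K|M. min 1 \<bar>h x + g x - f x\<bar>) = (LINT x:K|M. min 1 \<bar>(h x - f x) + g x\<bar>)"
      by (simp add: algebra_simps)
    also have "\<dots> \<le> (LINT x:K|M. min 1 \<bar>h x - f x\<bar>) + (LINT x:K|M. min 1 \<bar>g x\<bar>)"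
      using K by (intro set_integral_trunc_add) auto
    finally have "(LINT x:K|M. min 1 \<bar>h x + g x - f x\<bar>) < \<epsilon>" using less' by simp
    then show "L0_add M H G \<in> L0_ball M K \<epsilon> f"
      unfolding h g using K by (simp add: L0_add_class class_in_L0_ball_iff)
  qed
  with less K show "\<exists>K'\<in>sets M. \<exists>\<delta>>0. emeasure M K' < \<infinity> \<and> L0_add M H ` L0_nhd M K' \<delta> \<subseteq> L0_ball M K \<epsilon> f"
    by (intro bexI[of _ K] exI[of _ ?\<delta>]) auto
qed

section \<open>Closedness of the line spanned by an indicator function\<close>

text \<open>All subsets of finite measure of the set where \<open>f\<close> and \<open>g\<close>
  differ are null, so by semifiniteness that set is null itself. This passes from local information,
  which is all that the topology provides, to equality in \<open>L0\<close>.\<close>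

lemma semifinite_AE_eq:
  fixes f g :: "'a \<Rightarrow> real"
  assumes sf: "semifinite M" and [measurable]: "f \<in> borel_measurable M" "g \<in> borel_measurable M"
    and ae: "\<And>K. K \<in> sets M \<Longrightarrow> emeasure M K < \<infinity> \<Longrightarrow> AE x in M. x \<in> K \<longrightarrow> f x = g x"
  shows "AE x in M. f x = g x"
proof -
  let ?N = "{x \<in> space M. f x \<noteq> g x}"
  have "?N \<in> sets M" by measurable
  then have "emeasure M ?N = (SUP B\<in>{B \<in> sets M. B \<subseteq> ?N \<and> emeasure M B < \<infinity>}. emeasure M B)"
    using sf unfolding semifinite_def by blast
  also have "\<dots> \<le> 0"
  proof (rule SUP_least)
    fix B assume "B \<in> {B \<in> sets M. B \<subseteq> ?N \<and> emeasure M B < \<infinity>}"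
    then have B: "B \<in> sets M" "B \<subseteq> ?N" "emeasure M B < \<infinity>" by auto
    from ae[OF B(1,3)] have "AE x in M. x \<notin> B" by eventually_elim (use B in auto)
    then show "emeasure M B \<le> 0" using B(1) by (simp add: AE_iff_null_sets[symmetric] null_setsD1)
  qed
  finally have "?N \<in> null_sets M" by (intro null_setsI) auto
  then show ?thesis by (rule AE_I') auto
qed

lemma set_integral_trunc_indicator:
  assumes "E \<in> sets M" "E \<subseteq> K"
  shows "(LINT x:K|M. min 1 \<bar>(a::real) * indicator E x\<bar>) = min 1 \<bar>a\<bar> * measure M E"
proof -
  have "(LINT x:K|M. min 1 \<bar>a * indicator E x\<bar>) = (LINT x|M. min 1 \<bar>a\<bar> * indicator E x)"
    unfolding set_lebesgue_integral_def
    by (rule arg_cong[where f = "integral\<^sup>L M"]) (use assms in \<open>auto simp: fun_eq_iff indicator_def\<close>)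
  also have "\<dots> = min 1 \<bar>a\<bar> * measure M E"
    using assms by (simp add: sets.Int_space_eq2)
  finally show ?thesis .
qed

text \<open>If two multiples of the indicator of \<open>E\<close> are both close to \<open>f\<close>
  on \<open>K\<close>, their coefficients are close to each other, provided that \<open>E\<close>
  has positive measure. This is the triangle inequality, the distance of the two multiples being
  computed exactly.\<close>

lemma trunc_indicator_triangle:
  fixes f :: "'a \<Rightarrow> real"
  assumes K: "K \<in> sets M" "emeasure M K < \<infinity>" and E: "E \<in> sets M" "E \<subseteq> K"
    and [measurable]: "f \<in> borel_measurable M"
  shows "min 1 \<bar>a - b\<bar> * measure M E
    \<le> (LINT x:K|M. min 1 \<bar>a * indicator E x - f x\<bar>) + (LINT x:K|M. min 1 \<bar>b * indicator E x - f x\<bar>)"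
proof -
  have "min 1 \<bar>a - b\<bar> * measure M E = (LINT x:K|M. min 1 \<bar>(a - b) * indicator E x\<bar>)"
    using E by (simp add: set_integral_trunc_indicator)
  also have "\<dots> = (LINT x:K|M. min 1 \<bar>(a * indicator E x - f x) + (f x - b * indicator E x)\<bar>)"
    by (simp add: algebra_simps)
  also have "\<dots> \<le> (LINT x:K|M. min 1 \<bar>a * indicator E x - f x\<bar>) + (LINT x:K|M. min 1 \<bar>f x - b * indicator E x\<bar>)"
    using K E by (intro set_integral_trunc_add) auto
  finally show ?thesis by (simp add: abs_minus_commute)
qed

text \<open>Approximation on \<open>E\<close> alone already gives a Cauchy sequence of coefficients
  with a limit \<open>l\<close>. Any approximating multiple on a larger set must have a coefficient
  near \<open>l\<close>, so \<open>l\<close> times the indicator approximates \<open>f\<close>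
  arbitrarily well on every set of finite measure.\<close>

lemma AE_eq_indicator_multiple_of_approx:
  fixes f :: "'a \<Rightarrow> real"
  assumes sf: "semifinite M" and E: "E \<in> sets M" "0 < emeasure M E" "emeasure M E < \<infinity>"
    and f [measurable]: "f \<in> borel_measurable M"
    and approx: "\<And>K \<epsilon>. \<lbrakk>K \<in> sets M; emeasure M K < \<infinity>; 0 < \<epsilon>\<rbrakk> \<Longrightarrow>
      \<exists>c. (LINT x:K|M. min 1 \<bar>c * indicator E x - f x\<bar>) < \<epsilon>"
  shows "\<exists>c. AE x in M. f x = c * indicator E x"
proof -
  define m where "m = measure M E"
  have m: "0 < m" using E by (simp add: m_def measure_def enn2real_positive_iff)
  have "\<forall>n. \<exists>c. (LINT x:E|M. min 1 \<bar>c * indicator E x - f x\<bar>) < 1 / Suc n"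
    using E by (intro allI approx) auto
  then obtain c where c: "\<And>n. (LINT x:E|M. min 1 \<bar>c n * indicator E x - f x\<bar>) < 1 / Suc n"
    by metis
  have "Cauchy c"
  proof (rule CauchyI)
    fix e :: real assume "0 < e"
    \<comment> \<open>The minimum with 1 appears because the integral only controls
      \<open>min 1 \<bar>c i - c j\<bar>\<close>; being below \<open>min 1 e\<close> forces the
      difference itself below \<open>e\<close>.\<close>
    then have "0 < min 1 e * m / 2" using m by simp
    then obtain N :: nat where N: "1 / Suc N < min 1 e * m / 2"
      using nat_approx_posE by (metis of_nat_Suc)
    have "norm (c i - c j) < e" if "N \<le> i" "N \<le> j" for i j
    proof -
      have le: "1 / Suc i \<le> 1 / Suc N" "1 / Suc j \<le> 1 / Suc N"
        using that by (auto simp: field_simps)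
      have "min 1 \<bar>c i - c j\<bar> * m < 1 / Suc i + 1 / Suc j"
        using trunc_indicator_triangle[of E M E f "c i" "c j"] E c[of i] c[of j] unfolding m_def by simp
      also have "\<dots> \<le> min 1 e * m" using le N by linarith
      finally have "min 1 \<bar>c i - c j\<bar> < min 1 e" using m by simp
      then have "\<bar>c i - c j\<bar> < e" by linarith
      then show ?thesis by simp
    qed
    then show "\<exists>N. \<forall>i\<ge>N. \<forall>j\<ge>N. norm (c i - c j) < e" by blast
  qed
  then obtain l where l: "c \<longlonglongrightarrow> l" using Cauchy_convergent convergent_def by blast
  \<comment> \<open>The triangle inequality on \<open>E\<close> compares \<open>a\<close> with
    \<open>c n\<close> up to an error 1 / (n + 1); letting \<open>n\<close> tend to infinity
    replaces \<open>c n\<close> by \<open>l\<close>.\<close>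
  have near: "min 1 \<bar>a - l\<bar> * m \<le> (LINT x:K|M. min 1 \<bar>a * indicator E x - f x\<bar>)"
    if K: "K \<in> sets M" "emeasure M K < \<infinity>" "E \<subseteq> K" for a K
  proof (rule LIMSEQ_le)
    show "(\<lambda>n. min 1 \<bar>a - c n\<bar> * m) \<longlonglongrightarrow> min 1 \<bar>a - l\<bar> * m"
      using l by (intro tendsto_intros)
    show "(\<lambda>n. (LINT x:K|M. min 1 \<bar>a * indicator E x - f x\<bar>) + 1 / Suc n)
        \<longlonglongrightarrow> (LINT x:K|M. min 1 \<bar>a * indicator E x - f x\<bar>)"
      using tendsto_add[OF tendsto_const LIMSEQ_inverse_real_of_nat]
      by (simp add: inverse_eq_divide)
    have "min 1 \<bar>a - c n\<bar> * m \<le> (LINT x:K|M. min 1 \<bar>a * indicator E x - f x\<bar>) + 1 / Suc n" for n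
    proof -
      have "min 1 \<bar>a - c n\<bar> * m \<le> (LINT x:E|M. min 1 \<bar>a * indicator E x - f x\<bar>)
          + (LINT x:E|M. min 1 \<bar>c n * indicator E x - f x\<bar>)"
        unfolding m_def using E by (intro trunc_indicator_triangle) auto
      also have "(LINT x:E|M. min 1 \<bar>a * indicator E x - f x\<bar>) \<le> (LINT x:K|M. min 1 \<bar>a * indicator E x - f x\<bar>)"
        using E K by (intro set_integral_trunc_mono) auto
      finally show ?thesis using c[of n] by linarith
    qed
    then show "\<exists>N. \<forall>n\<ge>N. min 1 \<bar>a - c n\<bar> * m
        \<le> (LINT x:K|M. min 1 \<bar>a * indicator E x - f x\<bar>) + 1 / Suc n" by blast
  qed
  have "AE x in M. f x = l * indicator E x"
  proof (rule semifinite_AE_eq[OF sf])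
    show "(\<lambda>x. l * indicator E x) \<in> borel_measurable M" using E by measurable
    fix K assume K: "K \<in> sets M" "emeasure M K < \<infinity>"
    \<comment> \<open>Enlarging \<open>K\<close> by \<open>E\<close> makes \<open>near\<close>
      applicable.\<close>
    define L where "L = K \<union> E"
    have "emeasure M L \<le> emeasure M K + emeasure M E"
      unfolding L_def using K E by (intro emeasure_subadditive) auto
    also have "\<dots> < \<infinity>" using K E by simp
    finally have L: "L \<in> sets M" "emeasure M L < \<infinity>" "E \<subseteq> L" "K \<subseteq> L"
      using K E by (auto simp: L_def)
    let ?d = "\<lambda>x. min 1 \<bar>l * indicator E x - f x\<bar>"
    have "(LINT x:L|M. ?d x) \<le> \<epsilon>" if "0 < \<epsilon>" for \<epsilon>
    proof -
      \<comment> \<open>Replacing \<open>a\<close> by \<open>l\<close> costs at most the error of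
        \<open>a\<close> once more, hence the half.\<close>
      obtain a where a: "(LINT x:L|M. min 1 \<bar>a * indicator E x - f x\<bar>) < \<epsilon> / 2"
        using approx[OF L(1,2), of "\<epsilon> / 2"] \<open>0 < \<epsilon>\<close> by auto
      have "(LINT x:L|M. ?d x) = (LINT x:L|M. min 1 \<bar>(l - a) * indicator E x + (a * indicator E x - f x)\<bar>)"
        by (simp add: algebra_simps)
      also have "\<dots> \<le> (LINT x:L|M. min 1 \<bar>(l - a) * indicator E x\<bar>) + (LINT x:L|M. min 1 \<bar>a * indicator E x - f x\<bar>)"
        using L E by (intro set_integral_trunc_add) auto
      also have "(LINT x:L|M. min 1 \<bar>(l - a) * indicator E x\<bar>) = min 1 \<bar>a - l\<bar> * m"
        using L E by (simp add: set_integral_trunc_indicator m_def abs_minus_commute)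
      also have "\<dots> \<le> (LINT x:L|M. min 1 \<bar>a * indicator E x - f x\<bar>)"
        by (rule near) (use L in auto)
      finally show ?thesis using a by simp
    qed
    then have "(LINT x:L|M. ?d x) \<le> 0" by (rule field_le_epsilon[of _ 0, simplified])
    moreover have "0 \<le> (LINT x:L|M. ?d x)"
      unfolding set_lebesgue_integral_def by (intro integral_nonneg_AE) auto
    ultimately have "(LINT x:L|M. ?d x) = 0" by simp
    moreover have "set_integrable M L ?d" using L E by (intro set_integrable_trunc) auto
    ultimately have "AE x in M. indicator L x *\<^sub>R ?d x = 0"
      unfolding set_lebesgue_integral_def set_integrable_def
      by (subst (asm) integral_nonneg_eq_0_iff_AE) auto
    then show "AE x in M. x \<in> K \<longrightarrow> f x = l * indicator E x"
      by eventually_elim (use L in \<open>auto simp: min_def split: if_splits\<close>)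
  qed fact
  then show ?thesis by blast
qed

section \<open>Spaces of block sequences\<close>

text \<open>Induction on \<open>C\<close>: two annihilators of the smaller set with supports in
  consecutive intervals can be combined so as to annihilate \<open>c\<close> too. The arbitrary left
  end \<open>m\<close> allows the second support to start where the first one ends.\<close>

lemma nonzero_annihilator:
  fixes C :: "(nat \<Rightarrow> real) set"
  assumes "finite C"
  shows "\<exists>n a. (\<exists>i\<in>{m..<n}. a i \<noteq> 0) \<and> (\<forall>c\<in>C. (\<Sum>i=m..<n. a i * c i) = 0)"
  using assms
proof (induction C arbitrary: m)
  case empty
  show ?case by (intro exI[of _ "Suc m"] exI[of _ "\<lambda>_. 1"]) auto
next
  case (insert c C)
  obtain n a where a: "\<exists>i\<in>{m..<n}. a i \<noteq> 0" "\<forall>d\<in>C. (\<Sum>i=m..<n. a i * d i) = 0"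
    using insert.IH[of m] by blast
  show ?case
  proof (cases "(\<Sum>i=m..<n. a i * c i) = 0")
    case True
    then show ?thesis using a by blast
  next
    case False
    obtain p b where b: "\<exists>i\<in>{n..<p}. b i \<noteq> 0" "\<forall>d\<in>C. (\<Sum>i=n..<p. b i * d i) = 0"
      using insert.IH[of n] by blast
    have mnp: "m \<le> n" "n \<le> p" using a(1) b(1) by auto
    \<comment> \<open>The factor is chosen so that the two contributions for \<open>c\<close>
      cancel. The second annihilator enters with coefficient 1, so the combination is nonzero even
      if \<open>t\<close> vanishes.\<close>
    define t where "t = (\<Sum>i=n..<p. b i * c i) / (\<Sum>i=m..<n. a i * c i)"
    define a' where "a' i = (if i < n then - t * a i else b i)" for i
    have sum: "(\<Sum>i=m..<p. a' i * d i) = - t * (\<Sum>i=m..<n. a i * d i) + (\<Sum>i=n..<p. b i * d i)" for d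
    proof -
      have "(\<Sum>i=m..<p. a' i * d i) = (\<Sum>i=m..<n. a' i * d i) + (\<Sum>i=n..<p. a' i * d i)"
        using mnp by (simp add: sum.atLeastLessThan_concat)
      then show ?thesis by (simp add: a'_def sum_distrib_left mult.assoc sum_negf)
    qed
    have "\<forall>d\<in>insert c C. (\<Sum>i=m..<p. a' i * d i) = 0"
      using a(2) b(2) False by (simp add: sum t_def)
    moreover have "\<exists>i\<in>{m..<p}. a' i \<noteq> 0"
    proof -
      obtain i where "i \<in> {n..<p}" "b i \<noteq> 0" using b(1) by blast
      then show ?thesis using mnp by (intro bexI[of _ i]) (auto simp: a'_def)
    qed
    ultimately show ?thesis by blast
  qed
qed

definition block_seq ::
  "'a measure \<Rightarrow> (nat \<Rightarrow> 'a set) \<Rightarrow> (nat \<Rightarrow> nat) \<Rightarrow> (nat \<Rightarrow> real) \<Rightarrow> nat \<Rightarrow> ('a \<Rightarrow> real) set" where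
  "block_seq M E \<kappa> c n = ae_class M (\<lambda>x. c (\<kappa> n) * indicator (E n) x)"

lemma AE_indicator_multiple_eq_iff:
  fixes a b :: real
  assumes "E \<in> sets M" "0 < emeasure M E"
  shows "(AE x in M. a * indicator E x = b * indicator E x) \<longleftrightarrow> a = b"
proof
  assume ae: "AE x in M. a * indicator E x = b * indicator E x"
  show "a = b"
  proof (rule ccontr)
    assume "a \<noteq> b"
    then have "AE x in M. x \<notin> E" using ae by (auto elim!: eventually_mono)
    then have "E \<in> null_sets M" using assms by (simp add: AE_iff_null_sets)
    then show False using assms by auto
  qed
qed simp

text \<open>Positivity of the measures and surjectivity of \<open>\<kappa>\<close> make all
  coefficients recoverable from the sequence of classes; finiteness makes each \<open>E n\<close> an
  admissible test set for the topology.\<close>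

locale block_system =
  fixes M :: "'a measure" and E :: "nat \<Rightarrow> 'a set" and \<kappa> :: "nat \<Rightarrow> nat"
  assumes E_sets [measurable]: "E n \<in> sets M"
    and E_pos: "0 < emeasure M (E n)"
    and E_fin: "emeasure M (E n) < \<infinity>"
    and surj_\<kappa>: "surj \<kappa>"
begin

lemma block_seq_inject: "block_seq M E \<kappa> c = block_seq M E \<kappa> d \<longleftrightarrow> c = d"
proof
  assume eq: "block_seq M E \<kappa> c = block_seq M E \<kappa> d"
  show "c = d"
  proof
    fix k
    obtain n where n: "\<kappa> n = k" using surj_\<kappa> by (metis surjD)
    have "AE x in M. c k * indicator (E n) x = d k * indicator (E n) x"
      using fun_cong[OF eq, of n] n by (simp add: block_seq_def ae_class_eq_iff)
    then show "c k = d k" using AE_indicator_multiple_eq_iff[OF E_sets E_pos] by blast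
  qed
qed simp

lemma zero_eq_block_seq: "vzero (L0_seqs M) = block_seq M E \<kappa> (\<lambda>_. 0)"
  by (simp add: L0_seqs_def block_seq_def fun_eq_iff)

lemma add_block_seq:
  "vadd (L0_seqs M) (block_seq M E \<kappa> c) (block_seq M E \<kappa> d) = block_seq M E \<kappa> (\<lambda>k. c k + d k)"
  by (simp add: L0_seqs_def block_seq_def fun_eq_iff L0_add_class distrib_right)

lemma scale_block_seq:
  "vscale (L0_seqs M) r (block_seq M E \<kappa> c) = block_seq M E \<kappa> (\<lambda>k. r * c k)"
  by (simp add: L0_seqs_def block_seq_def fun_eq_iff L0_scale_class mult.assoc)

lemma block_seq_in_topspace: "block_seq M E \<kappa> c \<in> topspace (vtop (L0_seqs M))"
  by (auto simp: topspace_L0_seqs L0_eq block_seq_def)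

lemma vec_subspace_block_seq:
  assumes "(\<lambda>_. 0) \<in> C" "\<And>c d. c \<in> C \<Longrightarrow> d \<in> C \<Longrightarrow> (\<lambda>k. c k + d k) \<in> C"
    and "\<And>r c. c \<in> C \<Longrightarrow> (\<lambda>k. r * c k) \<in> C"
  shows "vec_subspace (L0_seqs M) (block_seq M E \<kappa> ` C)"
  using assms block_seq_in_topspace
  by (auto simp: vec_subspace_def zero_eq_block_seq add_block_seq scale_block_seq)

text \<open>Finitely many members of the range satisfy a common nontrivial linear equation in their
  coefficients, so their span is not the whole range.\<close>

lemma infinite_dimensional_block_seq: "infinite_dimensional (L0_seqs M) (range (block_seq M E \<kappa>))"
  unfolding infinite_dimensional_def
proof
  assume "\<exists>B. finite B \<and> B \<subseteq> range (block_seq M E \<kappa>) \<and>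
    vec_subspace (L0_seqs M) hull B = range (block_seq M E \<kappa>)"
  then obtain C where C: "finite C"
      "vec_subspace (L0_seqs M) hull (block_seq M E \<kappa> ` C) = range (block_seq M E \<kappa>)"
    by (metis finite_subset_image)
  obtain n a where a: "\<exists>i\<in>{0..<n}. a i \<noteq> 0" "\<forall>c\<in>C. (\<Sum>i=0..<n. a i * c i) = 0"
    using nonzero_annihilator[OF C(1), of 0] by blast
  \<comment> \<open>The solutions of the equation give a subspace containing the supposed
    generators, hence everything; a unit sequence at an \<open>i\<close> with
    \<open>a i \<noteq> 0\<close> violates the equation.\<close>
  define C' where "C' = {c. (\<Sum>i=0..<n. a i * c i) = 0}"
  have "vec_subspace (L0_seqs M) (block_seq M E \<kappa> ` C')"
  proof (rule vec_subspace_block_seq)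
    fix r c assume "c \<in> C'"
    moreover have "(\<Sum>i=0..<n. a i * (r * c i)) = r * (\<Sum>i=0..<n. a i * c i)"
      by (simp add: sum_distrib_left ac_simps)
    ultimately show "(\<lambda>k. r * c k) \<in> C'" by (simp add: C'_def)
  qed (auto simp: C'_def distrib_left sum.distrib)
  moreover have "block_seq M E \<kappa> ` C \<subseteq> block_seq M E \<kappa> ` C'" using a(2) by (auto simp: C'_def)
  ultimately have "range (block_seq M E \<kappa>) \<subseteq> block_seq M E \<kappa> ` C'"
    unfolding C(2)[symmetric] by (intro hull_minimal)
  then have all: "c \<in> C'" for c by (auto simp: block_seq_inject image_iff subset_iff)
  obtain i where i: "i < n" "a i \<noteq> 0" using a(1) by auto
  have "(\<Sum>j=0..<n. a j * (if j = i then 1 else 0)) = a i"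
    using i by (simp add: mult_delta_right)
  moreover have "(\<lambda>j. if j = i then 1 else 0) \<in> C'" by (rule all)
  ultimately show False using i(2) by (simp add: C'_def)
qed

end

section \<open>Comparison of the modes of convergence\<close>

lemma seq_classes_mono:
  assumes "\<And>f. (\<And>n. f n \<in> borel_measurable M) \<Longrightarrow> P f \<Longrightarrow> Q f"
  shows "seq_classes M P \<subseteq> seq_classes M Q"
  using assms unfolding seq_classes_def by blast

lemma S_u_subset_S_au: "S_u M \<subseteq> S_au M"
  unfolding S_u_def S_au_def
proof (rule seq_classes_mono, intro allI impI)
  fix f :: "nat \<Rightarrow> 'a \<Rightarrow> real" and \<epsilon> :: real
  assume *: "\<exists>Z\<in>sets M. emeasure M Z = 0 \<and> uniform_limit (space M - Z) f (\<lambda>x. 0) sequentially"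
    and "0 < \<epsilon>"
  from * obtain Z where "Z \<in> sets M" "emeasure M Z = 0"
      "uniform_limit (space M - Z) f (\<lambda>x. 0) sequentially" by blast
  then show "\<exists>Z\<in>sets M. emeasure M Z < ennreal \<epsilon> \<and> uniform_limit (space M - Z) f (\<lambda>x. 0) sequentially"
    using \<open>0 < \<epsilon>\<close> by (intro bexI[of _ Z]) simp_all
qed

text \<open>The exceptional sets for \<epsilon> = 1 / (j + 1) have a null intersection, and a point
  outside it avoids one of them, where convergence is uniform.\<close>

lemma S_au_subset_S_p: "S_au M \<subseteq> S_p M"
  unfolding S_au_def S_p_def
proof (rule seq_classes_mono)
  fix f :: "nat \<Rightarrow> 'a \<Rightarrow> real"
  assume *: "\<forall>\<epsilon>>0::real. \<exists>Z\<in>sets M. emeasure M Z < ennreal \<epsilon> \<and>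
      uniform_limit (space M - Z) f (\<lambda>x. 0) sequentially"
  have "\<forall>j::nat. \<exists>Z\<in>sets M. emeasure M Z < ennreal (1 / Suc j) \<and>
      uniform_limit (space M - Z) f (\<lambda>x. 0) sequentially"
    by (intro allI *[rule_format]) simp
  then obtain Z where Z: "\<And>j. Z j \<in> sets M" "\<And>j. emeasure M (Z j) < ennreal (1 / Suc j)"
      "\<And>j. uniform_limit (space M - Z j) f (\<lambda>x. 0) sequentially"
    by metis
  have "emeasure M (\<Inter>j. Z j) \<le> 0"
  proof (rule LIMSEQ_le_const)
    show "(\<lambda>j. ennreal (1 / Suc j)) \<longlonglongrightarrow> 0"
      using tendsto_ennrealI[OF LIMSEQ_inverse_real_of_nat] by (simp add: inverse_eq_divide)
    have "emeasure M (\<Inter>j. Z j) \<le> ennreal (1 / Suc j)" for j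
    proof -
      have "emeasure M (\<Inter>j. Z j) \<le> emeasure M (Z j)" using Z(1) by (intro emeasure_mono) auto
      then show ?thesis using Z(2)[of j] by simp
    qed
    then show "\<exists>N. \<forall>j\<ge>N. emeasure M (\<Inter>j. Z j) \<le> ennreal (1 / Suc j)" by blast
  qed
  then have "(\<Inter>j. Z j) \<in> null_sets M" using Z(1) by (auto intro!: null_setsI sets.countable_INT)
  then have "AE x in M. x \<notin> (\<Inter>j. Z j)" by (rule AE_not_in)
  with AE_space show "AE x in M. (\<lambda>n. f n x) \<longlonglongrightarrow> 0"
  proof eventually_elim
    case (elim x)
    then obtain j where "x \<in> space M - Z j" by blast
    then show ?case by (rule tendsto_uniform_limitI[OF Z(3)])
  qed
qed

text \<open>Borel-Cantelli for each threshold 1 / (j + 1); the countably many exceptional null sets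
  are then discarded together.\<close>

lemma S_c_subset_S_p: "S_c M \<subseteq> S_p M"
  unfolding S_c_def S_p_def
proof (rule seq_classes_mono)
  fix f :: "nat \<Rightarrow> 'a \<Rightarrow> real"
  assume [measurable]: "\<And>n. f n \<in> borel_measurable M"
    and *: "\<forall>\<epsilon>>0. (\<Sum>n. emeasure M {x \<in> space M. \<bar>f n x\<bar> > \<epsilon>}) < \<infinity>"
  have "AE x in M. eventually (\<lambda>n. \<bar>f n x\<bar> \<le> 1 / Suc j) sequentially" for j :: nat
  proof -
    let ?A = "\<lambda>n. {x \<in> space M. \<bar>f n x\<bar> > 1 / Suc j}"
    have sum: "(\<Sum>n. emeasure M (?A n)) < \<infinity>" using * by simp
    then have fin: "emeasure M (?A n) < \<infinity>" for n
      using ennreal_suminf_lessD by blast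
    then have eq: "emeasure M (?A n) = ennreal (measure M (?A n))" for n
      by (intro emeasure_eq_ennreal_measure) (metis infinity_ennreal_def less_irrefl)
    have "summable (\<lambda>n. measure M (?A n))"
    proof (rule summable_suminf_not_top)
      show "(\<Sum>n. ennreal (measure M (?A n))) \<noteq> top" unfolding eq[symmetric] using sum by simp
    qed simp
    with fin have "AE x in M. eventually (\<lambda>n. x \<in> space M - ?A n) sequentially"
      by (intro borel_cantelli_AE1) auto
    then show ?thesis
      by eventually_elim (auto elim!: eventually_mono simp: not_less)
  qed
  then have "AE x in M. \<forall>j::nat. eventually (\<lambda>n. \<bar>f n x\<bar> \<le> 1 / Suc j) sequentially"
    by (subst AE_all_countable) blast
  then show "AE x in M. (\<lambda>n. f n x) \<longlonglongrightarrow> 0"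
  proof eventually_elim
    case (elim x)
    show ?case
    proof (rule tendstoI)
      fix e :: real assume "0 < e"
      then obtain j :: nat where j: "1 / Suc j < e" using nat_approx_posE by (metis of_nat_Suc)
      from elim[rule_format, of j] show "eventually (\<lambda>n. dist (f n x) 0 < e) sequentially"
        by eventually_elim (use j in simp)
    qed
  qed
qed

lemma spaceable_mono: "spaceable X A \<Longrightarrow> A \<subseteq> B \<Longrightarrow> spaceable X B"
  unfolding spaceable_def by blast

section \<open>Spaceability\<close>

context block_system
begin

text \<open>A point of the closure is, coordinate by coordinate, a limit of multiples of the
  indicator of \<open>E n\<close>, hence such a multiple. It remains to see that its coefficient
  depends on \<open>\<kappa> n\<close> only.\<close>

lemma closedin_block_seq:
  assumes sf: "semifinite M"
  shows "closedin (vtop (L0_seqs M)) (range (block_seq M E \<kappa>))"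
proof -
  have "F \<in> range (block_seq M E \<kappa>)"
    if F: "F \<in> vtop (L0_seqs M) closure_of range (block_seq M E \<kappa>)" for F
  proof -
    have F_top: "F \<in> topspace (vtop (L0_seqs M))" using F by (simp add: in_closure_of)
    then have "\<forall>n. \<exists>f. f \<in> borel_measurable M \<and> F n = ae_class M f" 
      by (auto simp: topspace_L0_seqs L0_eq PiE_iff)
    then obtain f where f: "\<And>n. f n \<in> borel_measurable M" "\<And>n. F n = ae_class M (f n)" by metis
    \<comment> \<open>Two coordinates are approximated by one and the same \<open>c\<close>; this is
      what links the coefficients at indices with equal \<open>\<kappa>\<close>.\<close>
    have approx: "\<exists>c. (LINT x:K|M. min 1 \<bar>c (\<kappa> n) * indicator (E n) x - f n x\<bar>) < \<epsilon> \<and>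
        (LINT x:K|M. min 1 \<bar>c (\<kappa> p) * indicator (E p) x - f p x\<bar>) < \<epsilon>"
      if K: "K \<in> sets M" "emeasure M K < \<infinity>" and "0 < \<epsilon>" for K \<epsilon> n p
    proof -
      let ?U = "\<lambda>q. {G \<in> topspace (vtop (L0_seqs M)). G q \<in> L0_ball M K \<epsilon> (f q)}"
      have "openin (vtop (L0_seqs M)) (?U q)" for q
        using continuous_map_product_projection[of q UNIV "\<lambda>_. L0_topology M"] openin_L0_ball[OF K f(1), of \<epsilon> q]
        by (intro openin_continuous_map_preimage) (auto simp: L0_seqs_def)
      then have "openin (vtop (L0_seqs M)) (?U n \<inter> ?U p)" by (intro openin_Int)
      moreover have "F q \<in> L0_ball M K \<epsilon> (f q)" for q
        using K \<open>0 < \<epsilon>\<close> f by (simp add: class_in_L0_ball_iff set_lebesgue_integral_def)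
      then have "F \<in> ?U n \<inter> ?U p" using F_top by simp
      ultimately have "\<exists>G\<in>range (block_seq M E \<kappa>). G \<in> ?U n \<inter> ?U p"
        using F[unfolded in_closure_of] by (metis (no_types, lifting))
      then obtain c where "block_seq M E \<kappa> c \<in> ?U n \<inter> ?U p" by blast
      then show ?thesis
        using K f by (auto simp: block_seq_def class_in_L0_ball_iff intro!: exI[of _ c])
    qed
    have "\<exists>a. AE x in M. f n x = a * indicator (E n) x" for n
    proof (rule AE_eq_indicator_multiple_of_approx[OF sf E_sets E_pos E_fin f(1)])
      fix K and \<epsilon> :: real assume "K \<in> sets M" "emeasure M K < \<infinity>" "0 < \<epsilon>"
      from approx[OF this, of n n] show "\<exists>a. (LINT x:K|M. min 1 \<bar>a * indicator (E n) x - f n x\<bar>) < \<epsilon>"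
        by blast
    qed
    then obtain a where a: "\<And>n. AE x in M. f n x = a n * indicator (E n) x" by metis
    then have Fa: "F n = ae_class M (\<lambda>x. a n * indicator (E n) x)" for n
      using f by (simp add: ae_class_eq_iff)
    have coeff_eq: "a n = a p" if "\<kappa> n = \<kappa> p" for n p
    proof (rule ccontr)
      assume "a n \<noteq> a p"
      define m where "m = min (measure M (E n)) (measure M (E p))"
      \<comment> \<open>Half the gap: \<open>c (\<kappa> n) = c (\<kappa> p)\<close> cannot be
        within \<open>r\<close> of both \<open>a n\<close> and \<open>a p\<close>. The minimum with
        1 below again accounts for the truncation.\<close>
      define r where "r = \<bar>a n - a p\<bar> / 2"
      define d where "d = min 1 r"
      have "0 < measure M (E q)" for q
        using E_pos[of q] E_fin[of q] by (simp add: measure_def enn2real_positive_iff)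
      then have m: "0 < m" by (simp add: m_def)
      have d: "0 < d" using \<open>a n \<noteq> a p\<close> by (simp add: d_def r_def)
      define K where "K = E n \<union> E p"
      have "emeasure M K \<le> emeasure M (E n) + emeasure M (E p)"
        unfolding K_def by (intro emeasure_subadditive) auto
      also have "\<dots> < \<infinity>" using E_fin by simp
      finally have K: "K \<in> sets M" "emeasure M K < \<infinity>" by (auto simp: K_def)
      obtain c where c: "\<And>q. q \<in> {n, p} \<Longrightarrow> (LINT x:K|M. min 1 \<bar>c (\<kappa> q) * indicator (E q) x - f q x\<bar>) < d * m"
        using approx[OF K, of "d * m" n p] d m by auto
      have near: "\<bar>c (\<kappa> q) - a q\<bar> < r" if q: "q \<in> {n, p}" for q
      proof -
        have zero: "(LINT x:K|M. min 1 \<bar>a q * indicator (E q) x - f q x\<bar>) = 0"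
          unfolding set_lebesgue_integral_def
          by (rule integral_eq_zero_AE) (use a[of q] in \<open>auto elim!: eventually_mono\<close>)
        have "min 1 \<bar>c (\<kappa> q) - a q\<bar> * m \<le> min 1 \<bar>c (\<kappa> q) - a q\<bar> * measure M (E q)"
          using q by (intro mult_left_mono) (auto simp: m_def)
        also have "\<dots> \<le> (LINT x:K|M. min 1 \<bar>c (\<kappa> q) * indicator (E q) x - f q x\<bar>)"
          using trunc_indicator_triangle[OF K E_sets _ f(1), of q "c (\<kappa> q)" "a q" q] zero q by (auto simp: K_def)
        also have "\<dots> < d * m" using q by (rule c)
        finally have "min 1 \<bar>c (\<kappa> q) - a q\<bar> < d" using m by simp
        then show ?thesis unfolding d_def by linarith
      qed
      have "\<bar>c (\<kappa> n) - a n\<bar> < r" "\<bar>c (\<kappa> n) - a p\<bar> < r"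
        using near[of n] near[of p] that by auto
      moreover have "2 * r \<le> \<bar>c (\<kappa> n) - a p\<bar> + \<bar>c (\<kappa> n) - a n\<bar>"
        using abs_triangle_ineq4[of "c (\<kappa> n) - a p" "c (\<kappa> n) - a n"] by (simp add: r_def)
      ultimately show False by simp
    qed
    \<comment> \<open>Any index in the fibre of \<open>\<kappa>\<close> over \<open>k\<close> yields
      the coefficient for \<open>k\<close>, by \<open>coeff_eq\<close>.\<close>
    have "F n = block_seq M E \<kappa> (\<lambda>k. a (inv \<kappa> k)) n" for n
    proof -
      have "a (inv \<kappa> (\<kappa> n)) = a n" by (rule coeff_eq[OF surj_f_inv_f[OF surj_\<kappa>]])
      then show ?thesis unfolding block_seq_def Fa by (simp only:)
    qed
    then have "F = block_seq M E \<kappa> (\<lambda>k. a (inv \<kappa> k))" by (rule ext)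
    then show ?thesis by simp
  qed
  then have "vtop (L0_seqs M) closure_of range (block_seq M E \<kappa>) \<subseteq> range (block_seq M E \<kappa>)"
    by (rule subsetI)
  moreover have "range (block_seq M E \<kappa>) \<subseteq> topspace (vtop (L0_seqs M))"
    by (intro image_subsetI block_seq_in_topspace)
  ultimately show ?thesis by (intro closure_of_subset_eq[THEN iffD1] conjI)
qed

text \<open>Whatever the size of the coefficients, the set where the \<open>n\<close>-th function
  exceeds \<epsilon> in modulus lies in \<open>E n\<close>.\<close>

lemma block_seq_in_S_m:
  assumes lim: "(\<lambda>n. emeasure M (E n)) \<longlonglongrightarrow> 0"
  shows "block_seq M E \<kappa> c \<in> S_m M"
proof -
  have "(\<lambda>n. emeasure M {x \<in> space M. \<bar>c (\<kappa> n) * indicator (E n) x\<bar> > \<epsilon>}) \<longlonglongrightarrow> 0" if "0 < \<epsilon>" for \<epsilon> :: real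
  proof (rule tendsto_sandwich[OF _ _ tendsto_const lim])
    show "\<forall>\<^sub>F n in sequentially.
        emeasure M {x \<in> space M. \<bar>c (\<kappa> n) * indicator (E n) x\<bar> > \<epsilon>} \<le> emeasure M (E n)"
      using that by (intro always_eventually allI emeasure_mono) (auto simp: indicator_def split: if_splits)
  qed auto
  then have "(\<lambda>n. ae_class M (\<lambda>x. c (\<kappa> n) * indicator (E n) x)) \<in> S_m M"
    by (subst seq_class_in_iff(4)) auto
  then show ?thesis by (simp add: block_seq_def[abs_def])
qed

lemma block_seq_notin_S_p:
  assumes A: "A \<in> sets M" "0 < emeasure M A"
    and inf: "\<And>k. AE x in M. x \<in> A \<longrightarrow> infinite {n. \<kappa> n = k \<and> x \<in> E n}"
    and c: "c k \<noteq> 0"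
  shows "block_seq M E \<kappa> c \<notin> S_p M"
proof
  assume "block_seq M E \<kappa> c \<in> S_p M"
  then have "(\<lambda>n. ae_class M (\<lambda>x. c (\<kappa> n) * indicator (E n) x)) \<in> S_p M"
    by (simp add: block_seq_def[abs_def])
  then have "AE x in M. (\<lambda>n. c (\<kappa> n) * indicator (E n) x) \<longlonglongrightarrow> 0"
    by (subst (asm) seq_class_in_iff(1)) auto
  with inf[of k] have "AE x in M. x \<notin> A"
  proof eventually_elim
    case (elim x)
    show ?case
    proof
      assume "x \<in> A"
      with elim(1) have infinite: "infinite {n. \<kappa> n = k \<and> x \<in> E n}" by blast
      \<comment> \<open>The tolerance is \<open>\<bar>c k\<bar>\<close> itself, which the values
        attain at infinitely many indices.\<close>
      have "\<forall>\<^sub>F n in cofinite. \<bar>c (\<kappa> n) * indicator (E n) x\<bar> < \<bar>c k\<bar>"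
        using tendstoD[OF elim(2), of "\<bar>c k\<bar>"] c by (simp add: cofinite_eq_sequentially)
      then have "finite {n. \<not> \<bar>c (\<kappa> n) * indicator (E n) x\<bar> < \<bar>c k\<bar>}"
        by (simp add: eventually_cofinite)
      moreover have "{n. \<kappa> n = k \<and> x \<in> E n} \<subseteq> {n. \<not> \<bar>c (\<kappa> n) * indicator (E n) x\<bar> < \<bar>c k\<bar>}"
        by auto
      ultimately show False using infinite finite_subset by blast
    qed
  qed
  then show False using A AE_iff_null_sets[of A M] by (auto simp: null_sets_def)
qed

end

theorem theorem3p5:
  fixes M :: "'a measure"
  assumes "emeasure M (space M) > 0"
    and "nonatomic M"
    and "semifinite M"
  shows "spaceable (L0_seqs M) (S_m M - S_p M) \<and>
         spaceable (L0_seqs M) (S_m M - S_c M) \<and>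
         spaceable (L0_seqs M) (S_m M - S_au M) \<and>
         spaceable (L0_seqs M) (S_m M - S_u M)"
proof -
  obtain A and E :: "nat \<Rightarrow> 'a set" and \<kappa> :: "nat \<Rightarrow> nat"
    where A: "A \<in> sets M" "0 < emeasure M A"
    and E: "\<And>n. E n \<in> sets M" "\<And>n. 0 < emeasure M (E n)" "\<And>n. emeasure M (E n) < \<infinity>"
      "(\<lambda>n. emeasure M (E n)) \<longlonglongrightarrow> 0"
    and inf: "\<And>k. AE x in M. x \<in> A \<longrightarrow> infinite {n. \<kappa> n = k \<and> x \<in> E n}"
    using typewriter_sequences[OF assms] by blast
  \<comment> \<open>A value missed by \<open>\<kappa>\<close> would leave the points of
    \<open>A\<close> unswept by that sequence, and \<open>A\<close> would be null.\<close>
  have "k \<in> range \<kappa>" for k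
  proof (rule ccontr)
    assume "k \<notin> range \<kappa>"
    then have "{n. \<kappa> n = k \<and> x \<in> E n} = {}" for x by auto
    with inf[of k] have "AE x in M. x \<notin> A" by simp
    then show False using A AE_iff_null_sets[of A M] by (auto simp: null_sets_def)
  qed
  then interpret block_system M E \<kappa> by unfold_locales (use E in blast)+
  have "block_seq M E \<kappa> c \<in> S_m M - S_p M" if nz: "block_seq M E \<kappa> c \<noteq> vzero (L0_seqs M)" for c
  proof -
    obtain k where "c k \<noteq> 0" using nz by (auto simp: zero_eq_block_seq block_seq_inject)
    then show ?thesis using block_seq_in_S_m[OF E(4)] block_seq_notin_S_p[OF A inf] by blast
  qed
  then have "range (block_seq M E \<kappa>) - {vzero (L0_seqs M)} \<subseteq> S_m M - S_p M" by blast
  moreover have "vec_subspace (L0_seqs M) (range (block_seq M E \<kappa>))"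
    by (rule vec_subspace_block_seq) auto
  ultimately have *: "spaceable (L0_seqs M) (S_m M - S_p M)"
    unfolding spaceable_def
    by (intro exI[of _ "range (block_seq M E \<kappa>)"] conjI closedin_block_seq[OF assms(3)]
      infinite_dimensional_block_seq)
  \<comment> \<open>Each of the other three modes implies pointwise convergence almost everywhere,
    so removing them from \<open>S_m M\<close> leaves a larger set.\<close>
  have sub: "S_c M \<subseteq> S_p M" "S_au M \<subseteq> S_p M" "S_u M \<subseteq> S_p M"
    by (rule S_c_subset_S_p S_au_subset_S_p order_trans[OF S_u_subset_S_au S_au_subset_S_p])+
  show ?thesis
    using * sub[THEN Diff_mono[OF order_refl], THEN spaceable_mono[OF *]] by simp
qed

end
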